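(* Fix $a>0$ and $\rho>0$ with $\rho\neq 2$. For every $T_0>0$ there exists a constant $C>0$, independent of $N$ and of the terminal time $T\in(0,T_0]$, such that the following holds for every $T\in(0,T_0]$, every $N=n^2$ with $n\in\{1,2,3,\dots\}$, and all initial data $[\boldsymbol{v}_{0,N},\boldsymbol{w}_{0,N}]\in\mathbb{R}^{N}\times\mathbb{R}^{N}=\mathbb{R}^{2N}$. Consider the finite dimensional control system $$\boldsymbol{v}_N'(t)=D_N\boldsymbol{w}_N(t),\qquad \boldsymbol{w}_N'(t)=-D_N\big(\boldsymbol{v}_N(t)+\rho\,\boldsymbol{w}_N(t)\big)+\boldsymbol{u}_N(t),\qquad [\boldsymbol{v}_N(0),\boldsymbol{w}_N(0)]=[\boldsymbol{v}_{0,N},\boldsymbol{w}_{0,N}],$$ where $D_N$ is the finite difference matrix defined in the context. Then there is a null controller $u_N^*\in L^2(0,T;\mathbb{R}^N)$, namely the one given by the explicit recipe in the context; that is, the solution of the system with $\boldsymbol{u}_N=u_N^*$ satisfies $[\boldsymbol{v}_N(T),\boldsymbol{w}_N(T)]=[0,0]$. Moreover, it satisfies, uniformly in $N$, $$\Big(\int_0^T\|u_N^*(t)\|_{\mathbb{R}^N}^2\,dt\Big)^{1/2}\le C\,T^{-3/2}\,\big\|[\boldsymbol{v}_{0,N},\boldsymbol{w}_{0,N}]\big\|_{\mathbb{R}^{2N}}.$$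
   Context: The norms $\|\cdot\|_{\mathbb{R}^N}$ and $\|\cdot\|_{\mathbb{R}^{2N}}$ are Euclidean norms. Finite difference matrix. Let $n\ge 1$ be an integer, $h=\frac{a}{n+1}$ and $N=n^2$. Let $I_n$ and $0_n$ be the $n\times n$ identity and zero matrices, and let $F_n$ be the $n\times n$ tridiagonal matrix with $4$ on the main diagonal and $-1$ on the first sub- and superdiagonals (all other entries $0$). Then $D_N$ is the $N\times N$ matrix, viewed as an $n\times n$ array of $n\times n$ blocks, equal to $\frac{1}{h^2}$ times the block tridiagonal matrix with diagonal blocks $F_n$, first sub- and superdiagonal blocks $-I_n$, and all other blocks $0_n$. (It is the standard five-point central-difference discretization of $-\Delta$ on the square $(0,a)^2$ with homogeneous Dirichlet boundary conditions. The control system is the corresponding semidiscretization of $v_t=Aw$, $w_t=-Av-\rho Aw+u$, where $A$ is the Dirichlet Laplacian $-\Delta$ on $(0,a)^2$.) Recipe for the controller. Put $$\mathcal{A}_{FD,N}=\begin{bmatrix}0_N & D_N\\ -D_N & -\rho D_N\end{bmatrix},\qquad \mathcal{B}_N=\begin{bmatrix}0_N\\ I_N\end{bmatrix},\qquad \mathcal{K}_N=[\mathcal{B}_N,\ \mathcal{A}_{FD,N}\mathcal{B}_N]=\begin{bmatrix}0_N & D_N\\ I_N & -\rho D_N\end{bmatrix}.$$ The $2N\times 2N$ matrix $\mathcal{K}_N$ is the Kalman matrix (Kalman index $k=1$). Let $$f_T(t)=\frac{t(T-t)}{\int_0^T s(T-s)\,ds}=\frac{6t(T-t)}{T^3},$$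 and define $N$-vector valued functions $\mu_0,\mu_1$ by $$\begin{bmatrix}\mu_0(t)\\ \mu_1(t)\end{bmatrix}=-\mathcal{K}_N^{-1}e^{\mathcal{A}_{FD,N}t}\begin{bmatrix}\boldsymbol{v}_{0,N}\\ \boldsymbol{w}_{0,N}\end{bmatrix}f_T(t),\qquad 0\le t\le T.$$ The controller is $u_N^*(t)=\mu_0(t)+\mu_1'(t)$. *)

theory Defs
  imports
    "HOL-Analysis.Analysis"
    "Jordan_Normal_Form.Gauss_Jordan_Elimination"
begin

text \<open>The dimension \<open>N = n\<^sup>2\<close> is quantified inside the statement, so vectors and matrices are
  those of Jordan_Normal_Form, whose dimensions are terms.\<close>

unbundle no vec_syntax

definition vnorm :: "real Matrix.vec \<Rightarrow> real" where
  "vnorm x = L2_set (\<lambda>i. x $ i) {..<dim_vec x}"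

definition mat_exp :: "real Matrix.mat \<Rightarrow> real Matrix.mat" where
  "mat_exp M = Matrix.mat (dim_row M) (dim_col M)
     (\<lambda>(i, j). \<Sum>k. (M ^\<^sub>m k) $$ (i, j) / fact k)"

definition F_mat :: "nat \<Rightarrow> real Matrix.mat" where
  "F_mat n = Matrix.mat n n
     (\<lambda>(i, j). if i = j then 4 else if i = Suc j \<or> j = Suc i then -1 else 0)"

definition D_block :: "nat \<Rightarrow> nat \<Rightarrow> nat \<Rightarrow> real Matrix.mat" where
  "D_block n p q =
     (if p = q then F_mat n
      else if p = Suc q \<or> q = Suc p then - 1\<^sub>m n
      else 0\<^sub>m n n)"

text \<open>Indices start at 0, so entry \<open>(i, j)\<close> lies in block \<open>(i div n, j div n)\<close> at
  position \<open>(i mod n, j mod n)\<close>.\<close>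

definition D_mat :: "real \<Rightarrow> nat \<Rightarrow> real Matrix.mat" where
  "D_mat a n = (let h = a / (real n + 1) in
     (1 / h\<^sup>2) \<cdot>\<^sub>m Matrix.mat (n\<^sup>2) (n\<^sup>2)
       (\<lambda>(i, j). D_block n (i div n) (j div n) $$ (i mod n, j mod n)))"

definition A_FD :: "real \<Rightarrow> real \<Rightarrow> nat \<Rightarrow> real Matrix.mat" where
  "A_FD a \<rho> n = four_block_mat
     (0\<^sub>m (n\<^sup>2) (n\<^sup>2)) (D_mat a n)
     (- D_mat a n)     ((- \<rho>) \<cdot>\<^sub>m D_mat a n)"

definition B_mat :: "nat \<Rightarrow> real Matrix.mat" where
  "B_mat n = 0\<^sub>m (n\<^sup>2) (n\<^sup>2) @\<^sub>r 1\<^sub>m (n\<^sup>2)"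

text \<open>The column augmentation \<open>[B, A B]\<close>: the lower blocks of \<open>four_block_mat\<close> have no rows.\<close>

definition Kalman_mat :: "real \<Rightarrow> real \<Rightarrow> nat \<Rightarrow> real Matrix.mat" where
  "Kalman_mat a \<rho> n = four_block_mat
     (B_mat n)         (A_FD a \<rho> n * B_mat n)
     (0\<^sub>m 0 (n\<^sup>2))     (0\<^sub>m 0 (n\<^sup>2))"

definition f_T :: "real \<Rightarrow> real \<Rightarrow> real" where
  "f_T T t = t * (T - t) / integral {0..T} (\<lambda>s. s * (T - s))"

definition mu ::
  "real \<Rightarrow> real \<Rightarrow> nat \<Rightarrow> real \<Rightarrow> real Matrix.vec \<Rightarrow> real Matrix.vec \<Rightarrow> real \<Rightarrow> real Matrix.vec" where
  "mu a \<rho> n T v0 w0 t =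
     f_T T t \<cdot>\<^sub>v (- (the (mat_inverse (Kalman_mat a \<rho> n)) *\<^sub>v
                    (mat_exp (t \<cdot>\<^sub>m A_FD a \<rho> n) *\<^sub>v (v0 @\<^sub>v w0))))"

definition mu0 ::
  "real \<Rightarrow> real \<Rightarrow> nat \<Rightarrow> real \<Rightarrow> real Matrix.vec \<Rightarrow> real Matrix.vec \<Rightarrow> real \<Rightarrow> real Matrix.vec" where
  "mu0 a \<rho> n T v0 w0 t = vec_first (mu a \<rho> n T v0 w0 t) (n\<^sup>2)"

definition mu1 ::
  "real \<Rightarrow> real \<Rightarrow> nat \<Rightarrow> real \<Rightarrow> real Matrix.vec \<Rightarrow> real Matrix.vec \<Rightarrow> real \<Rightarrow> real Matrix.vec" where
  "mu1 a \<rho> n T v0 w0 t = vec_last (mu a \<rho> n T v0 w0 t) (n\<^sup>2)"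

text \<open>The formula for \<open>mu1\<close> makes sense for every real \<open>t\<close>, so the two-sided \<open>deriv\<close> is
  available also at the end points of \<open>[0, T]\<close>.\<close>

definition u_star ::
  "real \<Rightarrow> real \<Rightarrow> nat \<Rightarrow> real \<Rightarrow> real Matrix.vec \<Rightarrow> real Matrix.vec \<Rightarrow> real \<Rightarrow> real Matrix.vec" where
  "u_star a \<rho> n T v0 w0 t =
     mu0 a \<rho> n T v0 w0 t +
     Matrix.vec (n\<^sup>2) (\<lambda>i. deriv (\<lambda>s. mu1 a \<rho> n T v0 w0 s $ i) t)"

definition in_L2 :: "real \<Rightarrow> nat \<Rightarrow> (real \<Rightarrow> real Matrix.vec) \<Rightarrow> bool" where
  "in_L2 T N u \<longleftrightarrow>
     (\<forall>t\<in>{0..T}. u t \<in> carrier_vec N) \<and>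
     (\<forall>i<N. (\<lambda>t. u t $ i) \<in> borel_measurable (lebesgue_on {0..T})) \<and>
     integrable (lebesgue_on {0..T}) (\<lambda>t. (vnorm (u t))\<^sup>2)"

text \<open>Classical solutions on \<open>[0, T]\<close> (one-sided derivatives at the end points). For continuous
  inputs, such as \<open>u_star\<close>, these are the same as absolutely continuous solutions.\<close>

definition is_solution ::
  "real \<Rightarrow> real \<Rightarrow> nat \<Rightarrow> real \<Rightarrow> real Matrix.vec \<Rightarrow> real Matrix.vec \<Rightarrow> (real \<Rightarrow> real Matrix.vec) \<Rightarrow>
   (real \<Rightarrow> real Matrix.vec) \<Rightarrow> (real \<Rightarrow> real Matrix.vec) \<Rightarrow> bool" where
  "is_solution a \<rho> n T v0 w0 u v w \<longleftrightarrow>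
     (\<forall>t\<in>{0..T}. v t \<in> carrier_vec (n\<^sup>2) \<and> w t \<in> carrier_vec (n\<^sup>2)) \<and>
     v 0 = v0 \<and> w 0 = w0 \<and>
     (\<forall>t\<in>{0..T}. \<forall>i<n\<^sup>2.
        ((\<lambda>s. v s $ i) has_real_derivative (D_mat a n *\<^sub>v w t) $ i) (at t within {0..T}) \<and>
        ((\<lambda>s. w s $ i) has_real_derivative
           (- (D_mat a n *\<^sub>v (v t + \<rho> \<cdot>\<^sub>v w t)) + u t) $ i) (at t within {0..T}))"

end

theory Submission
  imports
    Defs
    "Jordan_Normal_Form.Determinant"
begin

text \<open>The controller comes from switching off the free motion. Write \<open>D\<close> for the discrete Laplacian,
  let \<open>(p, q) = e\<^bsup>A t\<^esup> (v0, w0)\<close> be the uncontrolled trajectory (\<open>free_v\<close> and \<open>free_w\<close>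
  in the locale \<open>free_system\<close>), so that \<open>p' = D q\<close> and
  \<open>q' = - D (p + \<rho> q)\<close>, and put \<open>\<zeta> = D\<^bsup>-1\<^esup> p\<close>, so that \<open>\<zeta>' = q\<close>. Solving with the Kalman matrix by back
  substitution gives \<open>mu0 = - f_T (q + \<rho> p)\<close> and \<open>mu1 = - f_T \<zeta>\<close>, hence
  \<open>u = - f_T (2 q + \<rho> p) - f_T' \<zeta>\<close> (lemma \<open>u_star_eq\<close>). With the cutoff \<open>F = 1 - \<integral>\<^sub>0\<^sup>t f_T\<close>, a direct
  computation shows that \<open>v = F p\<close> and \<open>w = F q - f_T \<zeta>\<close> solve the controlled system
  (\<open>controlled_solution\<close>). As \<open>F\<close> falls from \<open>1\<close> to \<open>0\<close> and \<open>f_T\<close> vanishes at both ends, this motion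
  starts at the data and ends at rest.

  Two facts about \<open>D\<close> control everything else. It is symmetric and positive, so the energy
  \<open>\<parallel>v\<parallel>\<^sup>2 + \<parallel>w\<parallel>\<^sup>2\<close> of the uncontrolled system cannot grow (\<open>damped_energy_nonincreasing\<close>); this yields
  uniqueness of solutions and bounds \<open>p\<close> and \<open>q\<close> by the data. And \<open>D\<close> is coercive with the
  mesh-independent constant \<open>8 / a\<^sup>2\<close> (\<open>D_mat_coercive\<close>, by a discrete supersolution), which makes
  the Kalman matrix invertible and bounds \<open>\<zeta>\<close> by \<open>a\<^sup>2 / 8\<close> times the data. Since \<open>f_T \<le> 3 / (2 T)\<close> and
  \<open>\<bar>f_T'\<bar> \<le> 6 / T\<^sup>2\<close>, the control is bounded pointwise by a constant times \<open>T\<^bsup>-2\<^esup>\<close> and in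
  \<open>L\<^sup>2(0, T)\<close> by a constant times \<open>T\<^bsup>-3/2\<^esup>\<close>, uniformly in \<open>n\<close>.\<close>

unbundle no inner_syntax

section \<open>Euclidean norm and scalar product\<close>

lemma vnorm_nonneg [simp]: "0 \<le> vnorm x"
  by (simp add: vnorm_def)

lemma vnorm_power2: "(vnorm x)\<^sup>2 = (\<Sum>i<dim_vec x. (x $ i)\<^sup>2)"
  by (simp add: vnorm_def L2_set_def sum_nonneg)

lemma vnorm_eq_0_iff: "vnorm x = 0 \<longleftrightarrow> x = 0\<^sub>v (dim_vec x)"
  by (auto simp: vnorm_def L2_set_eq_0_iff intro!: eq_vecI)
     (metis index_zero_vec(1))

lemma vnorm_append_power2: "(vnorm (x @\<^sub>v y))\<^sup>2 = (vnorm x)\<^sup>2 + (vnorm y)\<^sup>2"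
proof -
  have "(\<Sum>i<m + n. ((x @\<^sub>v y) $ i)\<^sup>2) = (\<Sum>i<m. (x $ i)\<^sup>2) + (\<Sum>i<n. (y $ i)\<^sup>2)"
    if "m = dim_vec x" "n = dim_vec y" for m n
    unfolding lessThan_atLeast0 sum.atLeastLessThan_concat[of 0 m "m + n", symmetric, simplified]
    using that sum.shift_bounds_nat_ivl[of "\<lambda>i. ((x @\<^sub>v y) $ i)\<^sup>2" 0 m n]
    by (simp add: add.commute)
  then show ?thesis
    by (simp add: vnorm_power2)
qed

lemma vnorm_smult: "vnorm (c \<cdot>\<^sub>v x) = \<bar>c\<bar> * vnorm x"
proof -
  have "vnorm (c \<cdot>\<^sub>v x) = L2_set (\<lambda>i. c * x $ i) {..<dim_vec x}"
    unfolding vnorm_def by (intro L2_set_cong) auto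
  then show ?thesis
    by (simp add: vnorm_def L2_set_def power_mult_distrib sum_distrib_left[symmetric] real_sqrt_mult)
qed

lemma vnorm_triangle:
  assumes "x \<in> carrier_vec N" and "y \<in> carrier_vec N"
  shows "vnorm (x + y) \<le> vnorm x + vnorm y"
proof -
  have "vnorm (x + y) = L2_set (\<lambda>i. x $ i + y $ i) {..<N}"
    unfolding vnorm_def using assms by (intro L2_set_cong) auto
  then show ?thesis
    using L2_set_triangle_ineq[of "\<lambda>i. x $ i" "\<lambda>i. y $ i" "{..<N}"] assms
    by (simp add: vnorm_def)
qed

lemma scalar_prod_le_vnorm:
  assumes "x \<in> carrier_vec N" and "y \<in> carrier_vec N"
  shows "x \<bullet> y \<le> vnorm x * vnorm y"
proof -
  have "x \<bullet> y \<le> (\<Sum>i<N. \<bar>x $ i\<bar> * \<bar>y $ i\<bar>)"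
    using assms unfolding scalar_prod_def lessThan_atLeast0
    by (auto intro!: sum_mono simp: abs_mult[symmetric])
  also have "\<dots> \<le> vnorm x * vnorm y"
    using assms L2_set_mult_ineq[of "\<lambda>i. x $ i" "\<lambda>i. y $ i" "{..<N}"] by (simp add: vnorm_def)
  finally show ?thesis .
qed

section \<open>Coercivity of the discrete Laplacian\<close>

text \<open>The function \<open>\<phi>\<close> plays the part of a first eigenvector. By the arithmetic-geometric mean
  inequality \<open>2 x\<^sub>i x\<^sub>j \<le> \<phi>\<^sub>j / \<phi>\<^sub>i x\<^sub>i\<^sup>2 + \<phi>\<^sub>i / \<phi>\<^sub>j x\<^sub>j\<^sup>2\<close>; multiplying by the nonpositive
  \<open>M\<^sub>i\<^sub>j\<close> reverses it, and on the diagonal it is an equality. The sum of the resulting lower bounds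
  is \<open>\<Sum>\<^sub>i (M \<phi>)\<^sub>i / \<phi>\<^sub>i x\<^sub>i\<^sup>2\<close>, because \<open>M\<close> is symmetric. No eigenvalue has to be known
  exactly.\<close>

lemma coercive_of_supersolution:
  fixes M :: "'a \<Rightarrow> 'a \<Rightarrow> real"
  assumes sym: "\<And>i j. i \<in> I \<Longrightarrow> j \<in> I \<Longrightarrow> M i j = M j i"
    and off: "\<And>i j. i \<in> I \<Longrightarrow> j \<in> I \<Longrightarrow> i \<noteq> j \<Longrightarrow> M i j \<le> 0"
    and pos: "\<And>i. i \<in> I \<Longrightarrow> 0 < \<phi> i"
    and super: "\<And>i. i \<in> I \<Longrightarrow> c * \<phi> i \<le> (\<Sum>j\<in>I. M i j * \<phi> j)"
  shows "c * (\<Sum>i\<in>I. (x i)\<^sup>2) \<le> (\<Sum>i\<in>I. \<Sum>j\<in>I. M i j * (x i * x j))"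
proof -
  \<comment> \<open>The \<open>x\<^sub>i\<close>-term of the mean inequality, weighted by \<open>M\<^sub>i\<^sub>j\<close>; its \<open>x\<^sub>j\<close>-term is \<open>S j i\<close>.\<close>
  define S where "S = (\<lambda>i j. M i j * (\<phi> j / \<phi> i * (x i)\<^sup>2))"
  have step: "(S i j + S j i) / 2 \<le> M i j * (x i * x j)" if "i \<in> I" "j \<in> I" for i j
  proof (cases "i = j")
    case True
    then show ?thesis
      using pos[of i] that by (simp add: S_def power2_eq_square)
  next
    case False
    have "0 \<le> \<phi> i * \<phi> j * (x i / \<phi> i - x j / \<phi> j)\<^sup>2"
      using pos[of i] pos[of j] that by simp
    also have "\<dots> = \<phi> j / \<phi> i * (x i)\<^sup>2 + \<phi> i / \<phi> j * (x j)\<^sup>2 - 2 * (x i * x j)"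
      using pos[of i] pos[of j] that by (simp add: field_simps power2_eq_square)
    finally have "M i j * (\<phi> j / \<phi> i * (x i)\<^sup>2 + \<phi> i / \<phi> j * (x j)\<^sup>2) \<le> M i j * (2 * (x i * x j))"
      using off[OF that False] by (intro mult_left_mono_neg) auto
    then show ?thesis
      using sym[OF that] by (simp add: S_def algebra_simps)
  qed
  have "c * (\<Sum>i\<in>I. (x i)\<^sup>2) = (\<Sum>i\<in>I. c * \<phi> i * ((x i)\<^sup>2 / \<phi> i))"
    unfolding sum_distrib_left using pos by (intro sum.cong) (auto simp: less_imp_neq[THEN not_sym])
  also have "\<dots> \<le> (\<Sum>i\<in>I. (\<Sum>j\<in>I. M i j * \<phi> j) * ((x i)\<^sup>2 / \<phi> i))"
    using pos super by (intro sum_mono mult_right_mono divide_nonneg_nonneg) (auto intro: less_imp_le)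
  also have "\<dots> = (\<Sum>i\<in>I. \<Sum>j\<in>I. S i j)"
    unfolding S_def sum_distrib_right by (intro sum.cong) auto
  also have "\<dots> = (\<Sum>i\<in>I. \<Sum>j\<in>I. (S i j + S j i) / 2)"
  proof -
    have "(\<Sum>i\<in>I. \<Sum>j\<in>I. S j i) = (\<Sum>i\<in>I. \<Sum>j\<in>I. S i j)"
      by (rule sum.swap)
    then show ?thesis
      by (simp add: sum_divide_distrib[symmetric] sum.distrib)
  qed
  also have "\<dots> \<le> (\<Sum>i\<in>I. \<Sum>j\<in>I. M i j * (x i * x j))"
    by (intro sum_mono step)
  finally show ?thesis .
qed

lemma D_mat_carrier [simp]: "D_mat a n \<in> carrier_mat (n\<^sup>2) (n\<^sup>2)"
  by (simp add: D_mat_def Let_def)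

lemma D_mat_dim [simp]: "dim_row (D_mat a n) = n\<^sup>2" "dim_col (D_mat a n) = n\<^sup>2"
  by (simp_all add: D_mat_def Let_def)

lemma D_mat_index:
  assumes "i < n\<^sup>2" and "j < n\<^sup>2"
  shows "D_mat a n $$ (i, j) =
    ((real n + 1) / a)\<^sup>2 * D_block n (i div n) (j div n) $$ (i mod n, j mod n)"
  using assms by (simp add: D_mat_def Let_def power_divide)

lemma D_block_index:
  assumes "r < n" and "s < n"
  shows "D_block n p q $$ (r, s) =
    (if p = q then (if r = s then 4 else if r = Suc s \<or> s = Suc r then -1 else 0)
     else if p = Suc q \<or> q = Suc p then (if r = s then -1 else 0) else 0)"
  using assms by (auto simp: D_block_def F_mat_def)

lemma sum_neighbours_le_2:
  assumes "finite S"
  shows "(\<Sum>s\<in>S. if r = Suc s \<or> s = Suc r then 1 else 0 :: real) \<le> 2"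
proof -
  have "(\<Sum>s\<in>S. if r = Suc s \<or> s = Suc r then 1 else 0 :: real)
      = real (card (S \<inter> {s. r = Suc s \<or> s = Suc r}))"
    using assms by (simp add: sum.If_cases)
  also have "card (S \<inter> {s. r = Suc s \<or> s = Suc r}) \<le> card {r - 1, Suc r}"
    by (intro card_mono) auto
  also have "card {r - 1, Suc r} \<le> 2"
    by (simp add: card_insert_if)
  finally show ?thesis by simp
qed

lemma sum_div_mod:
  fixes G :: "nat \<Rightarrow> nat \<Rightarrow> real"
  shows "(\<Sum>j<n * n. G (j div n) (j mod n)) = (\<Sum>q<n. \<Sum>s<n. G q s)"
proof -
  have "(\<Sum>j\<in>{q * n..<q * n + n}. G (j div n) (j mod n)) = (\<Sum>s<n. G q s)" for q
    using sum.shift_bounds_nat_ivl[of "\<lambda>j. G (j div n) (j mod n)" 0 "q * n" n]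
    by (simp add: lessThan_atLeast0 add.commute)
  then show ?thesis
    by (simp flip: sum.nat_group)
qed

text \<open>Summing over the position inside a block eliminates that coordinate: what remains dominates the
  one-dimensional second difference in the block index. The surplus sits in the first and last
  position of a diagonal block, where a neighbour is missing.\<close>

lemma D_block_row_sum:
  assumes "r < n"
  shows "(if p = q then 2 else if p = Suc q \<or> q = Suc p then -1 else 0)
    \<le> (\<Sum>s<n. D_block n p q $$ (r, s))"
proof -
  have "(\<Sum>s<n. if r = s then 4 else if r = Suc s \<or> s = Suc r then -1 else 0 :: real)
      = (\<Sum>s<n. (if s = r then 4 else 0) - (if r = Suc s \<or> s = Suc r then 1 else 0))"
    by (intro sum.cong) auto
  also have "\<dots> \<ge> 2"
    using sum_neighbours_le_2[of "{..<n}" r] assms by (simp add: sum_subtractf)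
  finally have diag: "2 \<le> (\<Sum>s<n. if r = s then 4 else if r = Suc s \<or> s = Suc r then -1 else 0 :: real)" .
  have "(\<Sum>s<n. D_block n p q $$ (r, s)) =
      (\<Sum>s<n. if p = q then (if r = s then 4 else if r = Suc s \<or> s = Suc r then -1 else 0)
        else if p = Suc q \<or> q = Suc p then (if r = s then -1 else 0) else 0)"
    using assms by (intro sum.cong refl D_block_index) auto
  then show ?thesis
    using assms diag by simp
qed

text \<open>The discrete solution of \<open>- \<phi>'' = 2\<close> that vanishes at the two grid points \<open>-1\<close> and \<open>n\<close> just
  outside the index range.\<close>

definition parabola :: "nat \<Rightarrow> nat \<Rightarrow> real" where
  "parabola n p = (real p + 1) * (real n - real p)"

lemma parabola_pos: "p < n \<Longrightarrow> 0 < parabola n p"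
  by (simp add: parabola_def)

lemma parabola_le: "parabola n p \<le> (real n + 1)\<^sup>2 / 4"
proof -
  have "0 \<le> (real n - 2 * real p - 1)\<^sup>2"
    by simp
  then show ?thesis
    by (simp add: parabola_def power2_eq_square field_simps)
qed

lemma parabola_second_difference:
  assumes "p < n"
  shows "(\<Sum>q<n. (if p = q then 2 else if p = Suc q \<or> q = Suc p then -1 else 0) * parabola n q) = 2"
proof -
  define g where "g = parabola n"
  have "(\<Sum>q<n. (if p = q then 2 else if p = Suc q \<or> q = Suc p then -1 else 0) * g q)
      = (\<Sum>q<n. (if q = p then 2 * g q else 0) - (if p = Suc q then g q else 0)
          - (if q = Suc p then g q else 0))"
    by (intro sum.cong) auto
  also have "\<dots> = 2 * g p - (\<Sum>q<n. if p = Suc q then g q else 0)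
      - (if Suc p < n then g (Suc p) else 0)"
    using assms by (simp add: sum_subtractf)
  also have "(\<Sum>q<n. if p = Suc q then g q else 0) = (case p of 0 \<Rightarrow> 0 | Suc k \<Rightarrow> g k)"
    using assms by (cases p) auto
  also have "(if Suc p < n then g (Suc p) else 0) = g (Suc p)"
    using assms by (cases "Suc p = n") (auto simp: g_def parabola_def)
  finally show ?thesis
    by (cases p) (auto simp: g_def parabola_def algebra_simps)
qed

lemma D_mat_symmetric: "transpose_mat (D_mat a n) = D_mat a n"
proof (rule eq_matI)
  fix i j assume "i < dim_row (D_mat a n)" "j < dim_col (D_mat a n)"
  then have ij: "i < n\<^sup>2" "j < n\<^sup>2"
    by auto
  then have "0 < n"
    by (cases n) auto
  then have "D_block n (j div n) (i div n) $$ (j mod n, i mod n)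
      = D_block n (i div n) (j div n) $$ (i mod n, j mod n)"
    by (auto simp: D_block_index)
  then show "transpose_mat (D_mat a n) $$ (i, j) = D_mat a n $$ (i, j)"
    using ij by (simp add: D_mat_index)
qed auto

text \<open>The parabola in the block index, constant inside blocks, is a supersolution: after scaling,
  \<open>D\<close> maps it to something that is at least \<open>2 / h\<^sup>2 = 2 (n + 1)\<^sup>2 / a\<^sup>2\<close>, while the parabola
  itself is at most \<open>(n + 1)\<^sup>2 / 4\<close>. The quotient \<open>8 / a\<^sup>2\<close> of these bounds does not depend on the
  mesh, which is the source of all uniformity in \<open>n\<close>.\<close>

lemma D_mat_coercive:
  assumes "0 < a" and x: "x \<in> carrier_vec (n\<^sup>2)"
  shows "8 / a\<^sup>2 * (vnorm x)\<^sup>2 \<le> x \<bullet> (D_mat a n *\<^sub>v x)"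
proof -
  define \<kappa> where "\<kappa> = ((real n + 1) / a)\<^sup>2"
  have "0 \<le> \<kappa>"
    by (simp add: \<kappa>_def)
  have dim: "dim_vec x = n\<^sup>2"
    using x by simp
  have "8 / a\<^sup>2 * (\<Sum>i<n\<^sup>2. (x $ i)\<^sup>2) \<le> (\<Sum>i<n\<^sup>2. \<Sum>j<n\<^sup>2. D_mat a n $$ (i, j) * (x $ i * x $ j))"
  proof (rule coercive_of_supersolution)
    fix i j assume "i \<in> {..<n\<^sup>2}" "j \<in> {..<n\<^sup>2}"
    then show "D_mat a n $$ (i, j) = D_mat a n $$ (j, i)"
      using D_mat_symmetric[of a n] by (metis D_mat_dim index_transpose_mat(1) lessThan_iff)
  next
    fix i j assume ij: "i \<in> {..<n\<^sup>2}" "j \<in> {..<n\<^sup>2}" "i \<noteq> j"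
    then have "0 < n"
      by (cases n) auto
    moreover have "\<not> (i div n = j div n \<and> i mod n = j mod n)"
      using ij by (metis div_mult_mod_eq)
    ultimately have "D_block n (i div n) (j div n) $$ (i mod n, j mod n) \<le> 0"
      by (auto simp: D_block_index)
    then show "D_mat a n $$ (i, j) \<le> 0"
      using ij by (auto simp: D_mat_index intro: mult_nonneg_nonpos)
  next
    fix i assume "i \<in> {..<n\<^sup>2}"
    then show "0 < parabola n (i div n)"
      by (intro parabola_pos) (simp add: power2_eq_square less_mult_imp_div_less)
  next
    fix i assume i: "i \<in> {..<n\<^sup>2}"
    define p r where "p = i div n" and "r = i mod n"
    have "0 < n"
      using i by (cases n) auto
    then have "p < n" "r < n"
      using i by (auto simp: p_def r_def power2_eq_square less_mult_imp_div_less)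
    have "2 = (\<Sum>q<n. (if p = q then 2 else if p = Suc q \<or> q = Suc p then -1 else 0) * parabola n q)"
      by (rule parabola_second_difference[OF \<open>p < n\<close>, symmetric])
    also have "\<dots> \<le> (\<Sum>q<n. (\<Sum>s<n. D_block n p q $$ (r, s)) * parabola n q)"
      by (intro sum_mono mult_right_mono D_block_row_sum[OF \<open>r < n\<close>] less_imp_le[OF parabola_pos]) simp
    also have "\<dots> = (\<Sum>q<n. \<Sum>s<n. D_block n p q $$ (r, s) * parabola n q)"
      by (simp add: sum_distrib_right)
    also have "\<dots> = (\<Sum>j<n\<^sup>2. D_block n p (j div n) $$ (r, j mod n) * parabola n (j div n))"
      unfolding power2_eq_square
      by (rule sum_div_mod[of "\<lambda>q s. D_block n p q $$ (r, s) * parabola n q", symmetric])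
    finally have "\<kappa> * 2 \<le> \<kappa> * (\<Sum>j<n\<^sup>2. D_block n p (j div n) $$ (r, j mod n) * parabola n (j div n))"
      using \<open>0 \<le> \<kappa>\<close> by (rule mult_left_mono)
    also have "\<dots> = (\<Sum>j<n\<^sup>2. D_mat a n $$ (i, j) * parabola n (j div n))"
      using i by (simp add: sum_distrib_left D_mat_index \<kappa>_def p_def r_def mult.assoc)
    finally have "\<kappa> * 2 \<le> (\<Sum>j<n\<^sup>2. D_mat a n $$ (i, j) * parabola n (j div n))" .
    moreover have "8 / a\<^sup>2 * parabola n p \<le> 8 / a\<^sup>2 * ((real n + 1)\<^sup>2 / 4)"
      by (intro mult_left_mono parabola_le) auto
    moreover have "8 / a\<^sup>2 * ((real n + 1)\<^sup>2 / 4) = \<kappa> * 2"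
      by (simp add: \<kappa>_def power_divide)
    ultimately show "8 / a\<^sup>2 * parabola n (i div n) \<le> (\<Sum>j<n\<^sup>2. D_mat a n $$ (i, j) * parabola n (j div n))"
      by (simp add: p_def)
  qed
  also have "(\<Sum>i<n\<^sup>2. \<Sum>j<n\<^sup>2. D_mat a n $$ (i, j) * (x $ i * x $ j)) = x \<bullet> (D_mat a n *\<^sub>v x)"
    by (auto simp: scalar_prod_def dim lessThan_atLeast0 sum_distrib_left mult_ac intro!: sum.cong)
  finally show ?thesis
    by (simp add: vnorm_power2 dim)
qed

text \<open>Coercivity combined with the Cauchy-Schwarz inequality; this is the bound
  \<open>\<parallel>D\<^bsup>-1\<^esup>\<parallel> \<le> a\<^sup>2 / 8\<close>, stated before any inverse is available.\<close>

lemma D_mat_inverse_bound: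
  assumes "0 < a" and z: "z \<in> carrier_vec (n\<^sup>2)"
  shows "vnorm z \<le> a\<^sup>2 / 8 * vnorm (D_mat a n *\<^sub>v z)"
proof (cases "vnorm z = 0")
  case False
  have "8 / a\<^sup>2 * (vnorm z)\<^sup>2 \<le> vnorm z * vnorm (D_mat a n *\<^sub>v z)"
    using D_mat_coercive[OF assms] scalar_prod_le_vnorm[OF z, of "D_mat a n *\<^sub>v z"]
      mult_mat_vec_carrier[OF D_mat_carrier z, of a] by linarith
  then have "vnorm z * (8 / a\<^sup>2 * vnorm z) \<le> vnorm z * vnorm (D_mat a n *\<^sub>v z)"
    by (simp add: power2_eq_square mult_ac)
  then have "8 / a\<^sup>2 * vnorm z \<le> vnorm (D_mat a n *\<^sub>v z)"
    using False by (subst (asm) mult_le_cancel_left_pos) (auto simp: less_le)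
  then show ?thesis
    using \<open>0 < a\<close> by (simp add: field_simps)
qed simp

lemma D_mat_injective:
  assumes "0 < a" and x: "x \<in> carrier_vec (n\<^sup>2)" and y: "y \<in> carrier_vec (n\<^sup>2)"
    and eq: "D_mat a n *\<^sub>v x = D_mat a n *\<^sub>v y"
  shows "x = y"
proof -
  have "D_mat a n *\<^sub>v (x - y) = 0\<^sub>v (n\<^sup>2)"
    using x y eq by (auto simp: mult_minus_distrib_mat_vec[OF D_mat_carrier] intro!: eq_vecI)
  then have "vnorm (x - y) \<le> 0"
    using D_mat_inverse_bound[OF \<open>0 < a\<close>, of "x - y" n] x y vnorm_eq_0_iff[of "0\<^sub>v (n\<^sup>2)"] by simp
  then have "vnorm (x - y) = 0"
    using vnorm_nonneg by (rule order.antisym)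
  then have "x - y = 0\<^sub>v (n\<^sup>2)"
    using vnorm_eq_0_iff[of "x - y"] y by simp
  show ?thesis
  proof (rule eq_vecI)
    fix i assume "i < dim_vec y"
    then have "(x - y) $ i = 0" and "i < n\<^sup>2"
      using \<open>x - y = 0\<^sub>v (n\<^sup>2)\<close> y by auto
    then show "x $ i = y $ i"
      using x y by simp
  qed (use x y in simp)
qed

section \<open>Componentwise derivatives of vector functions\<close>

text \<open>The vectors carry their dimension in the value and form no normed space, so differentiation
  is expressed entry by entry; the derivative \<open>x'\<close> supplies the dimension.\<close>

definition has_comp_deriv ::
  "(real \<Rightarrow> real Matrix.vec) \<Rightarrow> real Matrix.vec \<Rightarrow> real filter \<Rightarrow> bool" where
  "has_comp_deriv x x' F \<longleftrightarrow>
     (\<forall>i<dim_vec x'. ((\<lambda>t. x t $ i) has_field_derivative x' $ i) F)"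

lemma has_comp_deriv_mult_mat_vec:
  assumes A: "A \<in> carrier_mat m N" and x: "\<And>t. x t \<in> carrier_vec N" and x': "x' \<in> carrier_vec N"
    and deriv: "has_comp_deriv x x' (at t within S)"
  shows "has_comp_deriv (\<lambda>t. A *\<^sub>v x t) (A *\<^sub>v x') (at t within S)"
  unfolding has_comp_deriv_def
proof (intro allI impI)
  fix i assume "i < dim_vec (A *\<^sub>v x')"
  then have i: "i < m"
    using A by simp
  have "((\<lambda>t. \<Sum>j<N. A $$ (i, j) * x t $ j) has_field_derivative (\<Sum>j<N. A $$ (i, j) * x' $ j))
      (at t within S)"
    using deriv x' by (intro DERIV_sum DERIV_cmult) (auto simp: has_comp_deriv_def)
  moreover have "(A *\<^sub>v y) $ i = (\<Sum>j<N. A $$ (i, j) * y $ j)" if "y \<in> carrier_vec N" for y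
    using A i that by (auto simp: scalar_prod_def lessThan_atLeast0 intro!: sum.cong)
  ultimately show "((\<lambda>t. (A *\<^sub>v x t) $ i) has_field_derivative (A *\<^sub>v x') $ i) (at t within S)"
    using x x' by simp
qed

lemma has_comp_deriv_vec_first:
  assumes "has_comp_deriv x x' F" and "\<And>t. x t \<in> carrier_vec (m + N)" and "x' \<in> carrier_vec (m + N)"
  shows "has_comp_deriv (\<lambda>t. vec_first (x t) m) (vec_first x' m) F"
  using assms by (auto simp: has_comp_deriv_def vec_first_def)

lemma has_comp_deriv_vec_last:
  assumes "has_comp_deriv x x' F" and "\<And>t. x t \<in> carrier_vec (m + N)" and "x' \<in> carrier_vec (m + N)"
  shows "has_comp_deriv (\<lambda>t. vec_last (x t) N) (vec_last x' N) F"
proof -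
  have "dim_vec (x t) = m + N" "dim_vec x' = m + N" for t
    using assms(2)[of t] assms(3) by auto
  then show ?thesis
    using assms(1) by (auto simp: has_comp_deriv_def vec_last_def)
qed

section \<open>The matrix exponential\<close>

lemma smult_pow_mat:
  fixes A :: "real Matrix.mat"
  assumes A: "A \<in> carrier_mat m m"
  shows "(c \<cdot>\<^sub>m A) ^\<^sub>m k = c ^ k \<cdot>\<^sub>m A ^\<^sub>m k"
proof (induction k)
  case 0
  show ?case
    using A by (intro eq_matI) auto
next
  case (Suc k)
  have Ak: "A ^\<^sub>m k \<in> carrier_mat m m"
    using A by simp
  have "(c ^ k \<cdot>\<^sub>m A ^\<^sub>m k) * (c \<cdot>\<^sub>m A) = (c ^ k * c) \<cdot>\<^sub>m (A ^\<^sub>m k * A)"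
    using A Ak by (intro eq_matI) auto
  then show ?case
    using Suc by (simp add: mult.commute)
qed

lemma pow_mat_Suc_left:
  fixes A :: "real Matrix.mat"
  assumes A: "A \<in> carrier_mat m m"
  shows "A ^\<^sub>m Suc k = A * A ^\<^sub>m k"
proof (induction k)
  case 0
  show ?case
    using A by simp
next
  case (Suc k)
  have "A ^\<^sub>m Suc (Suc k) = (A * A ^\<^sub>m k) * A"
    using Suc by simp
  also have "\<dots> = A * (A ^\<^sub>m k * A)"
    using A pow_carrier_mat[OF A] by (intro assoc_mult_mat) auto
  finally show ?case
    by simp
qed

text \<open>A crude geometric bound; it only has to make the exponential series converge for every time.\<close>

lemma pow_mat_entry_le:
  fixes A :: "real Matrix.mat"
  assumes A: "A \<in> carrier_mat m m" and "i < m" and "j < m"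
  shows "\<bar>(A ^\<^sub>m k) $$ (i, j)\<bar> \<le> (\<Sum>l<m. \<Sum>j<m. \<bar>A $$ (l, j)\<bar>) ^ k"
  using \<open>j < m\<close>
proof (induction k arbitrary: j)
  case 0
  then show ?case
    using A \<open>i < m\<close> by simp
next
  case (Suc k)
  let ?B = "\<Sum>l<m. \<Sum>j<m. \<bar>A $$ (l, j)\<bar>"
  have Ak: "A ^\<^sub>m k \<in> carrier_mat m m"
    using A by simp
  have "(A ^\<^sub>m Suc k) $$ (i, j) = (\<Sum>l<m. (A ^\<^sub>m k) $$ (i, l) * A $$ (l, j))"
    using A Ak Suc.prems \<open>i < m\<close> by (auto simp: scalar_prod_def lessThan_atLeast0 intro!: sum.cong)
  then have "\<bar>(A ^\<^sub>m Suc k) $$ (i, j)\<bar> \<le> (\<Sum>l<m. \<bar>(A ^\<^sub>m k) $$ (i, l)\<bar> * \<bar>A $$ (l, j)\<bar>)"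
    by (simp add: abs_mult[symmetric])
  also have "\<dots> \<le> (\<Sum>l<m. ?B ^ k * (\<Sum>j<m. \<bar>A $$ (l, j)\<bar>))"
    using Suc
    by (intro sum_mono mult_mono member_le_sum) (auto intro!: zero_le_power sum_nonneg)
  also have "\<dots> = ?B ^ k * ?B"
    by (simp only: sum_distrib_left)
  also have "\<dots> = ?B ^ Suc k"
    by simp
  finally show ?case .
qed

lemma mat_exp_carrier: "A \<in> carrier_mat m m \<Longrightarrow> mat_exp A \<in> carrier_mat m m"
  by (simp add: mat_exp_def)

lemma mat_exp_index:
  assumes A: "A \<in> carrier_mat m m" and "i < m" and "j < m"
  shows "mat_exp (t \<cdot>\<^sub>m A) $$ (i, j) = (\<Sum>k. (A ^\<^sub>m k) $$ (i, j) / fact k * t ^ k)"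
  using assms pow_carrier_mat[OF A]
  by (auto simp: mat_exp_def smult_pow_mat[OF A] mult.commute intro!: suminf_cong)

lemma summable_mat_exp:
  fixes A :: "real Matrix.mat"
  assumes A: "A \<in> carrier_mat m m" and "i < m" and "j < m"
  shows "summable (\<lambda>k. (A ^\<^sub>m k) $$ (i, j) / fact k * t ^ k)"
proof (rule summable_comparison_test)
  let ?B = "\<Sum>l<m. \<Sum>j<m. \<bar>A $$ (l, j)\<bar>"
  show "summable (\<lambda>k. inverse (fact k) * (?B * \<bar>t\<bar>) ^ k)"
    by (rule summable_exp)
  have "\<bar>(A ^\<^sub>m k) $$ (i, j)\<bar> * \<bar>t\<bar> ^ k \<le> ?B ^ k * \<bar>t\<bar> ^ k" for k
    using pow_mat_entry_le[OF assms, of k] by (intro mult_right_mono) auto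
  then show "\<exists>N. \<forall>k\<ge>N. norm ((A ^\<^sub>m k) $$ (i, j) / fact k * t ^ k)
      \<le> inverse (fact k) * (?B * \<bar>t\<bar>) ^ k"
    by (auto simp: abs_mult power_abs power_mult_distrib divide_simps)
qed

text \<open>Each entry is a power series in \<open>t\<close> that converges everywhere, so it may be differentiated term
  by term.\<close>

lemma mat_exp_deriv_index:
  fixes A :: "real Matrix.mat"
  assumes A: "A \<in> carrier_mat m m" and i: "i < m" and j: "j < m"
  shows "((\<lambda>t. mat_exp (t \<cdot>\<^sub>m A) $$ (i, j)) has_field_derivative
    (A * mat_exp (t \<cdot>\<^sub>m A)) $$ (i, j)) (at t)"
proof -
  let ?c = "\<lambda>i k. (A ^\<^sub>m k) $$ (i, j) / fact k"
  have E: "mat_exp (t \<cdot>\<^sub>m A) \<in> carrier_mat m m"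
    using A by (intro mat_exp_carrier) auto
  have diffs: "diffs (?c i) k * t ^ k = (\<Sum>l<m. A $$ (i, l) * (?c l k * t ^ k))" for k
  proof -
    have "(A ^\<^sub>m Suc k) $$ (i, j) = (\<Sum>l<m. A $$ (i, l) * (A ^\<^sub>m k) $$ (l, j))"
      unfolding pow_mat_Suc_left[OF A] using A pow_carrier_mat[OF A, of k] i j
      by (auto simp: scalar_prod_def lessThan_atLeast0 intro!: sum.cong)
    moreover have "diffs (?c i) k = (A ^\<^sub>m Suc k) $$ (i, j) / fact k"
      unfolding diffs_def fact_Suc by (simp del: pow_mat.simps of_nat_Suc)
    ultimately show ?thesis
      by (simp add: sum_distrib_right sum_divide_distrib mult.assoc del: pow_mat.simps)
  qed
  have "((\<lambda>t. \<Sum>k. ?c i k * t ^ k) has_field_derivative (\<Sum>k. diffs (?c i) k * t ^ k)) (at t)"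
    using summable_mat_exp[OF A i j] by (rule termdiffs_strong_converges_everywhere)
  also have "(\<Sum>k. diffs (?c i) k * t ^ k) = (\<Sum>k. \<Sum>l<m. A $$ (i, l) * (?c l k * t ^ k))"
    by (simp only: diffs)
  also have "\<dots> = (\<Sum>l<m. \<Sum>k. A $$ (i, l) * (?c l k * t ^ k))"
    using summable_mat_exp[OF A _ j] by (intro suminf_sum summable_mult) auto
  also have "\<dots> = (\<Sum>l<m. A $$ (i, l) * (\<Sum>k. ?c l k * t ^ k))"
    using summable_mat_exp[OF A _ j] by (intro sum.cong refl suminf_mult) auto
  also have "\<dots> = (A * mat_exp (t \<cdot>\<^sub>m A)) $$ (i, j)"
    using A E i j mat_exp_index[OF A _ j]
    by (auto simp: scalar_prod_def lessThan_atLeast0 intro!: sum.cong)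
  finally show ?thesis
    by (simp add: mat_exp_index[OF A i j])
qed

lemma mat_exp_zero:
  fixes A :: "real Matrix.mat"
  assumes A: "A \<in> carrier_mat m m"
  shows "mat_exp (0 \<cdot>\<^sub>m A) = 1\<^sub>m m"
proof (rule eq_matI)
  fix i j assume "i < dim_row (1\<^sub>m m :: real Matrix.mat)" "j < dim_col (1\<^sub>m m :: real Matrix.mat)"
  then show "mat_exp (0 \<cdot>\<^sub>m A) $$ (i, j) = 1\<^sub>m m $$ (i, j)"
    using A by (simp add: mat_exp_index[OF A] powser_zero del: times_divide_eq_left)
qed (use A in \<open>auto simp: mat_exp_def\<close>)

lemma mat_exp_orbit_deriv:
  fixes A :: "real Matrix.mat"
  assumes A: "A \<in> carrier_mat m m" and y: "y \<in> carrier_vec m"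
  shows "has_comp_deriv (\<lambda>t. mat_exp (t \<cdot>\<^sub>m A) *\<^sub>v y) (A *\<^sub>v (mat_exp (t \<cdot>\<^sub>m A) *\<^sub>v y)) (at t)"
  unfolding has_comp_deriv_def
proof (intro allI impI)
  have E: "mat_exp (s \<cdot>\<^sub>m A) \<in> carrier_mat m m" for s
    using A by (intro mat_exp_carrier) auto
  fix i assume "i < dim_vec (A *\<^sub>v (mat_exp (t \<cdot>\<^sub>m A) *\<^sub>v y))"
  then have i: "i < m"
    using A by simp
  have expand: "(B *\<^sub>v y) $ i = (\<Sum>j<m. B $$ (i, j) * y $ j)" if "B \<in> carrier_mat m m" for B
    using that i y by (auto simp: scalar_prod_def lessThan_atLeast0 intro!: sum.cong)
  have "((\<lambda>s. \<Sum>j<m. mat_exp (s \<cdot>\<^sub>m A) $$ (i, j) * y $ j) has_field_derivative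
      (\<Sum>j<m. (A * mat_exp (t \<cdot>\<^sub>m A)) $$ (i, j) * y $ j)) (at t)"
    using mat_exp_deriv_index[OF A i] by (intro DERIV_sum DERIV_cmult_right) auto
  moreover have "A *\<^sub>v (mat_exp (t \<cdot>\<^sub>m A) *\<^sub>v y) = (A * mat_exp (t \<cdot>\<^sub>m A)) *\<^sub>v y"
    by (rule assoc_mult_mat_vec[OF A E y, symmetric])
  ultimately show "((\<lambda>s. (mat_exp (s \<cdot>\<^sub>m A) *\<^sub>v y) $ i) has_field_derivative
      (A *\<^sub>v (mat_exp (t \<cdot>\<^sub>m A) *\<^sub>v y)) $ i) (at t)"
    using A E by (simp add: expand)
qed

section \<open>Energy decay\<close>

lemma scalar_prod_mult_mat_vec_sym:
  fixes D :: "real Matrix.mat"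
  assumes "D \<in> carrier_mat N N" and "transpose_mat D = D"
    and "x \<in> carrier_vec N" and "y \<in> carrier_vec N"
  shows "x \<bullet> (D *\<^sub>v y) = y \<bullet> (D *\<^sub>v x)"
  using transpose_vec_mult_scalar[of D N N y x] assms by (simp add: comm_scalar_prod[of _ N])

text \<open>The coupling terms \<open>p \<bullet> D q\<close> and \<open>q \<bullet> D p\<close> cancel by symmetry, so that the derivative of the
  energy is \<open>- 2 \<rho> (q \<bullet> D q) \<le> 0\<close>. The derivatives may be one-sided at the end points: this form
  is applied both to the free motion and to the difference of two solutions on \<open>[0, T]\<close>.\<close>

lemma damped_energy_nonincreasing:
  fixes D :: "real Matrix.mat"
  assumes D: "D \<in> carrier_mat N N" and sym: "transpose_mat D = D"
    and psd: "\<And>x. x \<in> carrier_vec N \<Longrightarrow> 0 \<le> x \<bullet> (D *\<^sub>v x)"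
    and "0 \<le> \<rho>" and "0 \<le> T"
    and carr: "\<And>t. t \<in> {0..T} \<Longrightarrow> p t \<in> carrier_vec N \<and> q t \<in> carrier_vec N"
    and p': "\<And>t. t \<in> {0..T} \<Longrightarrow> has_comp_deriv p (D *\<^sub>v q t) (at t within {0..T})"
    and q': "\<And>t. t \<in> {0..T} \<Longrightarrow>
      has_comp_deriv q (- (D *\<^sub>v (p t + \<rho> \<cdot>\<^sub>v q t))) (at t within {0..T})"
  shows "(vnorm (p T))\<^sup>2 + (vnorm (q T))\<^sup>2 \<le> (vnorm (p 0))\<^sup>2 + (vnorm (q 0))\<^sup>2"
proof -
  define e where "e = (\<lambda>t. (\<Sum>i<N. (p t $ i)\<^sup>2 + (q t $ i)\<^sup>2))"
  have e_vnorm: "e t = (vnorm (p t))\<^sup>2 + (vnorm (q t))\<^sup>2" if "t \<in> {0..T}" for t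
    using carr[OF that] by (auto simp: e_def vnorm_power2 sum.distrib)
  have e': "(e has_real_derivative - 2 * \<rho> * (q t \<bullet> (D *\<^sub>v q t))) (at t within {0..T})"
    if t: "t \<in> {0..T}" for t
  proof -
    have c: "p t \<in> carrier_vec N" "q t \<in> carrier_vec N"
      using carr[OF t] by auto
    have "(e has_real_derivative (\<Sum>i<N. 2 * (p t $ i * (D *\<^sub>v q t) $ i)
        - 2 * (q t $ i * (D *\<^sub>v (p t + \<rho> \<cdot>\<^sub>v q t)) $ i))) (at t within {0..T})"
      unfolding e_def
      using p'[OF t] q'[OF t] D
      by (intro DERIV_sum) (auto simp: has_comp_deriv_def intro!: derivative_eq_intros)
    also have "(\<Sum>i<N. 2 * (p t $ i * (D *\<^sub>v q t) $ i)
        - 2 * (q t $ i * (D *\<^sub>v (p t + \<rho> \<cdot>\<^sub>v q t)) $ i))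
      = 2 * (p t \<bullet> (D *\<^sub>v q t)) - 2 * (q t \<bullet> (D *\<^sub>v (p t + \<rho> \<cdot>\<^sub>v q t)))"
      using D by (simp add: scalar_prod_def sum_subtractf sum_distrib_left lessThan_atLeast0)
    also have "q t \<bullet> (D *\<^sub>v (p t + \<rho> \<cdot>\<^sub>v q t)) = q t \<bullet> (D *\<^sub>v p t) + \<rho> * (q t \<bullet> (D *\<^sub>v q t))"
      using D c by (simp add: mult_add_distrib_mat_vec[OF D] mult_mat_vec[OF D]
          scalar_prod_add_distrib[of _ N])
    also have "q t \<bullet> (D *\<^sub>v p t) = p t \<bullet> (D *\<^sub>v q t)"
      using D sym c(2,1) by (rule scalar_prod_mult_mat_vec_sym)
    finally show ?thesis
      by (simp add: algebra_simps)
  qed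
  have "e T \<le> e 0"
  proof (rule DERIV_nonpos_imp_decreasing_open[OF \<open>0 \<le> T\<close>])
    fix t assume t: "0 < t" "t < T"
    then have "(e has_real_derivative - 2 * \<rho> * (q t \<bullet> (D *\<^sub>v q t))) (at t)"
      using e'[of t] by (simp add: at_within_Icc_at)
    moreover have "- 2 * \<rho> * (q t \<bullet> (D *\<^sub>v q t)) \<le> 0"
      using psd[of "q t"] carr[of t] t \<open>0 \<le> \<rho>\<close> by (simp add: mult_nonneg_nonneg)
    ultimately show "\<exists>y. (e has_real_derivative y) (at t) \<and> y \<le> 0"
      by blast
  next
    show "continuous_on {0..T} e"
      using e' by (rule DERIV_continuous_on)
  qed
  then show ?thesis
    using \<open>0 \<le> T\<close> by (simp add: e_vnorm)
qed

section \<open>The Kalman matrix\<close>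

lemma A_FD_carrier: "A_FD a \<rho> n \<in> carrier_mat (n\<^sup>2 + n\<^sup>2) (n\<^sup>2 + n\<^sup>2)"
  unfolding A_FD_def by (intro four_block_carrier_mat) auto

lemma A_FD_mult_append:
  assumes x: "x \<in> carrier_vec (n\<^sup>2)" and y: "y \<in> carrier_vec (n\<^sup>2)"
  shows "A_FD a \<rho> n *\<^sub>v (x @\<^sub>v y) = D_mat a n *\<^sub>v y @\<^sub>v - (D_mat a n *\<^sub>v (x + \<rho> \<cdot>\<^sub>v y))"
proof -
  have "A_FD a \<rho> n *\<^sub>v (x @\<^sub>v y) =
     (0\<^sub>m (n\<^sup>2) (n\<^sup>2) *\<^sub>v x + D_mat a n *\<^sub>v y) @\<^sub>v (- D_mat a n *\<^sub>v x + (- \<rho>) \<cdot>\<^sub>m D_mat a n *\<^sub>v y)"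
    unfolding A_FD_def using x y by (intro four_block_mat_mult_vec) auto
  also have "0\<^sub>m (n\<^sup>2) (n\<^sup>2) *\<^sub>v x + D_mat a n *\<^sub>v y = D_mat a n *\<^sub>v y"
    using x y by (intro eq_vecI) auto
  also have "- D_mat a n *\<^sub>v x + (- \<rho>) \<cdot>\<^sub>m D_mat a n *\<^sub>v y = - (D_mat a n *\<^sub>v (x + \<rho> \<cdot>\<^sub>v y))"
    using x y
    by (intro eq_vecI) (auto simp: mult_add_distrib_mat_vec[OF D_mat_carrier] mult_mat_vec[OF D_mat_carrier] )
  finally show ?thesis .
qed

lemma Kalman_mat_eq:
  "Kalman_mat a \<rho> n = four_block_mat (0\<^sub>m (n\<^sup>2) (n\<^sup>2)) (D_mat a n) (1\<^sub>m (n\<^sup>2)) ((- \<rho>) \<cdot>\<^sub>m D_mat a n)"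
proof -
  have B: "B_mat n = four_block_mat (0\<^sub>m (n\<^sup>2) (n\<^sup>2)) (0\<^sub>m (n\<^sup>2) 0) (1\<^sub>m (n\<^sup>2)) (0\<^sub>m (n\<^sup>2) 0)"
    by (simp add: B_mat_def append_rows_def)
  have "A_FD a \<rho> n * B_mat n = four_block_mat (0\<^sub>m (n\<^sup>2) (n\<^sup>2) * 0\<^sub>m (n\<^sup>2) (n\<^sup>2) + D_mat a n * 1\<^sub>m (n\<^sup>2))
      (0\<^sub>m (n\<^sup>2) (n\<^sup>2) * 0\<^sub>m (n\<^sup>2) 0 + D_mat a n * 0\<^sub>m (n\<^sup>2) 0)
      (- D_mat a n * 0\<^sub>m (n\<^sup>2) (n\<^sup>2) + (- \<rho>) \<cdot>\<^sub>m D_mat a n * 1\<^sub>m (n\<^sup>2))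
      (- D_mat a n * 0\<^sub>m (n\<^sup>2) 0 + (- \<rho>) \<cdot>\<^sub>m D_mat a n * 0\<^sub>m (n\<^sup>2) 0)"
    unfolding A_FD_def B by (rule mult_four_block_mat) auto
  also have "\<dots> = D_mat a n @\<^sub>r ((- \<rho>) \<cdot>\<^sub>m D_mat a n)"
    unfolding append_rows_def by (intro eq_matI) auto
  finally show ?thesis
    unfolding Kalman_mat_def by (intro eq_matI) (auto simp: B_mat_def append_rows_def intro!: gr0I)
qed

lemma Kalman_mat_carrier: "Kalman_mat a \<rho> n \<in> carrier_mat (n\<^sup>2 + n\<^sup>2) (n\<^sup>2 + n\<^sup>2)"
  unfolding Kalman_mat_eq by (intro four_block_carrier_mat) auto

lemma Kalman_mat_mult_append:
  assumes x: "x \<in> carrier_vec (n\<^sup>2)" and y: "y \<in> carrier_vec (n\<^sup>2)"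
  shows "Kalman_mat a \<rho> n *\<^sub>v (x @\<^sub>v y) = D_mat a n *\<^sub>v y @\<^sub>v (x - \<rho> \<cdot>\<^sub>v (D_mat a n *\<^sub>v y))"
proof -
  have "Kalman_mat a \<rho> n *\<^sub>v (x @\<^sub>v y) =
     (0\<^sub>m (n\<^sup>2) (n\<^sup>2) *\<^sub>v x + D_mat a n *\<^sub>v y) @\<^sub>v (1\<^sub>m (n\<^sup>2) *\<^sub>v x + (- \<rho>) \<cdot>\<^sub>m D_mat a n *\<^sub>v y)"
    unfolding Kalman_mat_eq using x y by (intro four_block_mat_mult_vec) auto
  also have "0\<^sub>m (n\<^sup>2) (n\<^sup>2) *\<^sub>v x + D_mat a n *\<^sub>v y = D_mat a n *\<^sub>v y"
    using x y by (intro eq_vecI) auto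
  also have "1\<^sub>m (n\<^sup>2) *\<^sub>v x + (- \<rho>) \<cdot>\<^sub>m D_mat a n *\<^sub>v y = x - \<rho> \<cdot>\<^sub>v (D_mat a n *\<^sub>v y)"
    using x y by (intro eq_vecI) auto
  finally show ?thesis .
qed

text \<open>A kernel vector \<open>(x, y)\<close> of the Kalman matrix satisfies \<open>D y = 0\<close> and \<open>x = \<rho> D y\<close>; since \<open>D\<close> is
  injective, the Gauss-Jordan inversion succeeds.\<close>

lemma Kalman_mat_inverse:
  fixes a \<rho> :: real and n :: nat
  defines "K \<equiv> the (mat_inverse (Kalman_mat a \<rho> n))"
  assumes "0 < a"
  shows "K \<in> carrier_mat (n\<^sup>2 + n\<^sup>2) (n\<^sup>2 + n\<^sup>2)" and "Kalman_mat a \<rho> n * K = 1\<^sub>m (n\<^sup>2 + n\<^sup>2)"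
proof -
  let ?K = "Kalman_mat a \<rho> n"
  have "Determinant.det ?K \<noteq> 0"
  proof
    assume "Determinant.det ?K = 0"
    then obtain z where z: "z \<in> carrier_vec (n\<^sup>2 + n\<^sup>2)" "z \<noteq> 0\<^sub>v (n\<^sup>2 + n\<^sup>2)" "?K *\<^sub>v z = 0\<^sub>v (n\<^sup>2 + n\<^sup>2)"
      using det_0_iff_vec_prod_zero_field[OF Kalman_mat_carrier] by blast
    define x y where "x = vec_first z (n\<^sup>2)" and "y = vec_last z (n\<^sup>2)"
    have xy: "x \<in> carrier_vec (n\<^sup>2)" "y \<in> carrier_vec (n\<^sup>2)" "z = x @\<^sub>v y"
      using z(1) by (simp_all add: x_def y_def)
    have "0\<^sub>v (n\<^sup>2 + n\<^sup>2) = 0\<^sub>v (n\<^sup>2) @\<^sub>v (0\<^sub>v (n\<^sup>2) :: real Matrix.vec)"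
      by (intro eq_vecI) auto
    then have "D_mat a n *\<^sub>v y @\<^sub>v (x - \<rho> \<cdot>\<^sub>v (D_mat a n *\<^sub>v y)) = 0\<^sub>v (n\<^sup>2) @\<^sub>v 0\<^sub>v (n\<^sup>2)"
      using z(3) Kalman_mat_mult_append[OF xy(1,2)] xy(3) by simp
    then have "D_mat a n *\<^sub>v y = 0\<^sub>v (n\<^sup>2)" and xz: "x - \<rho> \<cdot>\<^sub>v (D_mat a n *\<^sub>v y) = 0\<^sub>v (n\<^sup>2)"
      using append_vec_eq[OF mult_mat_vec_carrier[OF D_mat_carrier xy(2)] zero_carrier_vec] by blast+
    moreover have "D_mat a n *\<^sub>v 0\<^sub>v (n\<^sup>2) = 0\<^sub>v (n\<^sup>2)"
      by (intro eq_vecI) auto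
    moreover have "x - \<rho> \<cdot>\<^sub>v 0\<^sub>v (n\<^sup>2) = x"
      using xy(1) by (intro eq_vecI) auto
    ultimately have "y = 0\<^sub>v (n\<^sup>2)" and "x = 0\<^sub>v (n\<^sup>2)"
      using D_mat_injective[OF \<open>0 < a\<close> xy(2), of "0\<^sub>v (n\<^sup>2)"] xy(1) by auto
    then show False
      using z(2) xy(3) \<open>0\<^sub>v (n\<^sup>2 + n\<^sup>2) = _\<close> by simp
  qed
  then have "?K \<in> Units (ring_mat TYPE(real) (n\<^sup>2 + n\<^sup>2) ())"
    by (rule det_non_zero_imp_unit[OF Kalman_mat_carrier])
  then obtain K' where "mat_inverse ?K = Some K'"
    using mat_inverse(1)[OF Kalman_mat_carrier, where b = "()"] by (cases "mat_inverse ?K") auto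
  then show "K \<in> carrier_mat (n\<^sup>2 + n\<^sup>2) (n\<^sup>2 + n\<^sup>2)" and "?K * K = 1\<^sub>m (n\<^sup>2 + n\<^sup>2)"
    using mat_inverse(2)[OF Kalman_mat_carrier] by (auto simp: K_def)
qed

text \<open>Solving with the Kalman matrix is back substitution: the lower half of the solution is
  \<open>D\<^bsup>-1\<^esup> p\<close>, and the upper half is then explicit.\<close>

lemma Kalman_mat_solve:
  fixes a \<rho> :: real and n :: nat and p q :: "real Matrix.vec"
  defines "z \<equiv> the (mat_inverse (Kalman_mat a \<rho> n)) *\<^sub>v (p @\<^sub>v q)"
  assumes "0 < a" and p: "p \<in> carrier_vec (n\<^sup>2)" and q: "q \<in> carrier_vec (n\<^sup>2)"
  shows "D_mat a n *\<^sub>v vec_last z (n\<^sup>2) = p" and "vec_first z (n\<^sup>2) = q + \<rho> \<cdot>\<^sub>v p"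
proof -
  define x y where "x = vec_first z (n\<^sup>2)" and "y = vec_last z (n\<^sup>2)"
  note K = Kalman_mat_inverse[OF \<open>0 < a\<close>, where \<rho> = \<rho> and n = n]
  have z: "z \<in> carrier_vec (n\<^sup>2 + n\<^sup>2)"
    unfolding z_def using K(1) p q by (intro mult_mat_vec_carrier[of _ "n\<^sup>2 + n\<^sup>2" "n\<^sup>2 + n\<^sup>2"]) auto
  then have xy: "x \<in> carrier_vec (n\<^sup>2)" "y \<in> carrier_vec (n\<^sup>2)" "z = x @\<^sub>v y"
    by (simp_all add: x_def y_def)
  have "Kalman_mat a \<rho> n *\<^sub>v z = (Kalman_mat a \<rho> n * the (mat_inverse (Kalman_mat a \<rho> n))) *\<^sub>v (p @\<^sub>v q)"
    unfolding z_def using K(1) Kalman_mat_carrier p q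
    by (intro assoc_mult_mat_vec[symmetric]) auto
  also have "\<dots> = p @\<^sub>v q"
    using K(2) p q by simp
  finally have "D_mat a n *\<^sub>v y @\<^sub>v (x - \<rho> \<cdot>\<^sub>v (D_mat a n *\<^sub>v y)) = p @\<^sub>v q"
    using Kalman_mat_mult_append[OF xy(1,2)] xy(3) by simp
  then have Dy: "D_mat a n *\<^sub>v y = p" and eq: "x - \<rho> \<cdot>\<^sub>v (D_mat a n *\<^sub>v y) = q"
    using append_vec_eq[OF mult_mat_vec_carrier[OF D_mat_carrier xy(2)] p] by blast+
  show "D_mat a n *\<^sub>v vec_last z (n\<^sup>2) = p"
    using Dy by (simp add: y_def)
  have "x = q + \<rho> \<cdot>\<^sub>v p"
    unfolding eq[symmetric] Dy using xy(1) p by (intro eq_vecI) auto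
  then show "vec_first z (n\<^sup>2) = q + \<rho> \<cdot>\<^sub>v p"
    by (simp add: x_def)
qed

section \<open>The free motion and the controller\<close>

lemma f_T_eq:
  assumes "0 < T"
  shows "f_T T t = 6 * t * (T - t) / T ^ 3"
proof -
  have "((\<lambda>s. s * (T - s)) has_integral (T * T\<^sup>2 / 2 - T ^ 3 / 3) - (T * 0\<^sup>2 / 2 - 0 ^ 3 / 3)) {0..T}"
    using assms
    by (intro fundamental_theorem_of_calculus)
       (auto simp: has_real_derivative_iff_has_vector_derivative[symmetric] algebra_simps power2_eq_square
         intro!: derivative_eq_intros)
  then have int: "integral {0..T} (\<lambda>s. s * (T - s)) = T ^ 3 / 6"
    by (simp add: integral_unique power2_eq_square power3_eq_cube)
  show ?thesis
    unfolding f_T_def int by simp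
qed

lemma f_T_deriv:
  assumes "0 < T"
  shows "(f_T T has_real_derivative 6 * (T - 2 * t) / T ^ 3) (at t within S)"
  unfolding f_T_eq[OF assms, abs_def]
  using assms by (auto intro!: derivative_eq_intros simp: field_simps)

lemma f_T_abs_le:
  assumes "t \<in> {0..T}" and "0 < T"
  shows "\<bar>f_T T t\<bar> \<le> 3 / (2 * T)"
proof -
  have "0 \<le> (T - 2 * t)\<^sup>2"
    by simp
  then have "t * (T - t) \<le> T\<^sup>2 / 4"
    by (simp add: power2_eq_square algebra_simps)
  moreover have "0 \<le> t * (T - t)"
    using assms by simp
  ultimately show ?thesis
    using assms by (simp add: f_T_eq divide_simps power2_eq_square power3_eq_cube)
qed

lemma f_T_deriv_abs_le:
  fixes t T :: real
  assumes "t \<in> {0..T}" and "0 < T"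
  shows "\<bar>6 * (T - 2 * t) / T ^ 3\<bar> \<le> 6 / T\<^sup>2"
proof -
  have "\<bar>T - 2 * t\<bar> \<le> T"
    using assms by auto
  then have "6 * \<bar>T - 2 * t\<bar> / T ^ 3 \<le> 6 * T / T ^ 3"
    using assms by (intro divide_right_mono) auto
  also have "6 * T / T ^ 3 = 6 / T\<^sup>2"
    using assms by (simp add: power2_eq_square power3_eq_cube)
  also have "6 * \<bar>T - 2 * t\<bar> / T ^ 3 = \<bar>6 * (T - 2 * t) / T ^ 3\<bar>"
    unfolding abs_divide abs_mult using assms by simp
  finally show ?thesis .
qed

text \<open>The function \<open>1 - \<integral>\<^sub>0\<^sup>t f_T\<close>: it starts at \<open>1\<close> and ends at \<open>0\<close>, because \<open>f_T\<close> has integral \<open>1\<close>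
  over \<open>[0, T]\<close>.\<close>

definition cutoff :: "real \<Rightarrow> real \<Rightarrow> real" where
  "cutoff T t = 1 - (3 * T * t\<^sup>2 - 2 * t ^ 3) / T ^ 3"

lemma cutoff_deriv:
  assumes "0 < T"
  shows "(cutoff T has_real_derivative - f_T T t) (at t within S)"
  unfolding cutoff_def[abs_def] f_T_eq[OF assms]
  using assms
  by (auto intro!: derivative_eq_intros simp: field_simps power2_eq_square)

lemma vec_first_append:
  assumes "x \<in> carrier_vec N"
  shows "vec_first (x @\<^sub>v y) N = x"
  using assms by (intro eq_vecI) (auto simp: vec_first_def)

lemma vec_last_append:
  assumes "y \<in> carrier_vec N"
  shows "vec_last (x @\<^sub>v y) N = y"
  using assms by (intro eq_vecI) (auto simp: vec_last_def)

locale free_system =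
  fixes a \<rho> :: real and n :: nat and v0 w0 :: "real Matrix.vec"
  assumes a_pos: "0 < a" and \<rho>_nonneg: "0 \<le> \<rho>"
    and v0: "v0 \<in> carrier_vec (n\<^sup>2)" and w0: "w0 \<in> carrier_vec (n\<^sup>2)"
begin

abbreviation "D \<equiv> D_mat a n"

definition orbit :: "real \<Rightarrow> real Matrix.vec" where
  "orbit t = mat_exp (t \<cdot>\<^sub>m A_FD a \<rho> n) *\<^sub>v (v0 @\<^sub>v w0)"

definition free_v :: "real \<Rightarrow> real Matrix.vec" where
  "free_v t = vec_first (orbit t) (n\<^sup>2)"

definition free_w :: "real \<Rightarrow> real Matrix.vec" where
  "free_w t = vec_last (orbit t) (n\<^sup>2)"

text \<open>The lower half of \<open>K\<^bsup>-1\<^esup>\<close> applied to the orbit, that is \<open>D\<^bsup>-1\<^esup> free_v\<close>.\<close>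

definition \<zeta> :: "real \<Rightarrow> real Matrix.vec" where
  "\<zeta> t = vec_last (the (mat_inverse (Kalman_mat a \<rho> n)) *\<^sub>v orbit t) (n\<^sup>2)"

lemma carriers [simp]: "free_v t \<in> carrier_vec (n\<^sup>2)" "free_w t \<in> carrier_vec (n\<^sup>2)" "\<zeta> t \<in> carrier_vec (n\<^sup>2)"
  by (simp_all add: free_v_def free_w_def \<zeta>_def)

lemma dims [simp]: "dim_vec (free_v t) = n\<^sup>2" "dim_vec (free_w t) = n\<^sup>2" "dim_vec (\<zeta> t) = n\<^sup>2"
  by (simp_all add: free_v_def free_w_def \<zeta>_def)

lemma orbit_carrier: "orbit t \<in> carrier_vec (n\<^sup>2 + n\<^sup>2)"
  unfolding orbit_def using v0 w0
  by (intro mult_mat_vec_carrier[of _ "n\<^sup>2 + n\<^sup>2" "n\<^sup>2 + n\<^sup>2"] mat_exp_carrier smult_carrier_mat A_FD_carrier) auto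

lemma orbit_eq: "orbit t = free_v t @\<^sub>v free_w t"
  unfolding free_v_def free_w_def by (rule vec_first_last_append[OF orbit_carrier, symmetric])

lemma orbit_deriv:
  "has_comp_deriv orbit (D *\<^sub>v free_w t @\<^sub>v - (D *\<^sub>v (free_v t + \<rho> \<cdot>\<^sub>v free_w t))) (at t)"
proof -
  have "has_comp_deriv orbit (A_FD a \<rho> n *\<^sub>v orbit t) (at t)"
    unfolding orbit_def[abs_def] using v0 w0 by (intro mat_exp_orbit_deriv[OF A_FD_carrier]) auto
  then show ?thesis
    by (simp add: orbit_eq A_FD_mult_append)
qed

lemma D_free_w_carrier: "D *\<^sub>v free_w t \<in> carrier_vec (n\<^sup>2)"
  by (rule mult_mat_vec_carrier[OF D_mat_carrier]) simp

lemma D_free_sum_carrier: "- (D *\<^sub>v (free_v t + \<rho> \<cdot>\<^sub>v free_w t)) \<in> carrier_vec (n\<^sup>2)"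
  by (intro uminus_carrier_vec[THEN iffD2] mult_mat_vec_carrier[OF D_mat_carrier]) simp

lemma free_v_deriv: "has_comp_deriv free_v (D *\<^sub>v free_w t) (at t)"
  using has_comp_deriv_vec_first[OF orbit_deriv orbit_carrier, of t] D_free_w_carrier D_free_sum_carrier
  by (simp add: free_v_def[abs_def] vec_first_append)

lemma free_w_deriv: "has_comp_deriv free_w (- (D *\<^sub>v (free_v t + \<rho> \<cdot>\<^sub>v free_w t))) (at t)"
  using has_comp_deriv_vec_last[OF orbit_deriv orbit_carrier, of t] D_free_w_carrier D_free_sum_carrier
  by (simp add: free_w_def[abs_def] vec_last_append)

lemma free_initial: "free_v 0 = v0" "free_w 0 = w0"
proof -
  have "orbit 0 = v0 @\<^sub>v w0"
    unfolding orbit_def using v0 w0 by (simp add: mat_exp_zero[OF A_FD_carrier])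
  then show "free_v 0 = v0" "free_w 0 = w0"
    using v0 w0 by (simp_all add: free_v_def free_w_def vec_first_append vec_last_append)
qed

lemma D_\<zeta>: "D *\<^sub>v \<zeta> t = free_v t"
  unfolding \<zeta>_def orbit_eq by (intro Kalman_mat_solve a_pos carriers)

text \<open>Since \<open>D \<zeta> = free_v\<close> and \<open>free_v' = D free_w\<close>, injectivity of \<open>D\<close> gives \<open>\<zeta>' = free_w\<close>.\<close>

lemma \<zeta>_deriv: "has_comp_deriv \<zeta> (free_w t) (at t)"
proof -
  let ?K = "the (mat_inverse (Kalman_mat a \<rho> n))"
  let ?y = "D *\<^sub>v free_w t @\<^sub>v - (D *\<^sub>v (free_v t + \<rho> \<cdot>\<^sub>v free_w t))"
  have K: "?K \<in> carrier_mat (n\<^sup>2 + n\<^sup>2) (n\<^sup>2 + n\<^sup>2)"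
    by (rule Kalman_mat_inverse(1)[OF a_pos])
  have y: "?y \<in> carrier_vec (n\<^sup>2 + n\<^sup>2)"
    using D_free_w_carrier D_free_sum_carrier by (rule append_carrier_vec)
  have "has_comp_deriv \<zeta> (vec_last (?K *\<^sub>v ?y) (n\<^sup>2)) (at t)"
    unfolding \<zeta>_def[abs_def]
    using has_comp_deriv_mult_mat_vec[OF K orbit_carrier y orbit_deriv]
    by (rule has_comp_deriv_vec_last[where m = "n\<^sup>2"])
       (auto intro!: mult_mat_vec_carrier[OF K] orbit_carrier y)
  moreover have "D *\<^sub>v vec_last (?K *\<^sub>v ?y) (n\<^sup>2) = D *\<^sub>v free_w t"
    by (rule Kalman_mat_solve(1)[OF a_pos D_free_w_carrier D_free_sum_carrier])
  then have "vec_last (?K *\<^sub>v ?y) (n\<^sup>2) = free_w t"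
    by (rule D_mat_injective[OF a_pos vec_last_carrier carriers(2)])
  ultimately show ?thesis
    by (simp only:)
qed

lemma index_deriv:
  assumes "i < n\<^sup>2"
  shows "((\<lambda>t. free_v t $ i) has_real_derivative (D *\<^sub>v free_w t) $ i) (at t within S)"
    and "((\<lambda>t. free_w t $ i) has_real_derivative - (D *\<^sub>v (free_v t + \<rho> \<cdot>\<^sub>v free_w t)) $ i) (at t within S)"
    and "((\<lambda>t. \<zeta> t $ i) has_real_derivative free_w t $ i) (at t within S)"
proof -
  have "((\<lambda>t. free_v t $ i) has_real_derivative (D *\<^sub>v free_w t) $ i) (at t)"
    and "((\<lambda>t. free_w t $ i) has_real_derivative - (D *\<^sub>v (free_v t + \<rho> \<cdot>\<^sub>v free_w t)) $ i) (at t)"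
    and "((\<lambda>t. \<zeta> t $ i) has_real_derivative free_w t $ i) (at t)"
    using free_v_deriv[of t] free_w_deriv[of t] \<zeta>_deriv[of t] assms by (auto simp: has_comp_deriv_def)
  note this[THEN has_field_derivative_at_within]
  then show "((\<lambda>t. free_v t $ i) has_real_derivative (D *\<^sub>v free_w t) $ i) (at t within S)"
    and "((\<lambda>t. free_w t $ i) has_real_derivative - (D *\<^sub>v (free_v t + \<rho> \<cdot>\<^sub>v free_w t)) $ i) (at t within S)"
    and "((\<lambda>t. \<zeta> t $ i) has_real_derivative free_w t $ i) (at t within S)"
    by blast+
qed

text \<open>In this form the factor \<open>D\<close> that the derivative of \<open>mu1\<close> produces has been absorbed: the control
  contains the free motion only through \<open>free_v\<close>, \<open>free_w\<close> and \<open>D\<^bsup>-1\<^esup> free_v\<close>, all of which are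
  bounded by multiples of the data that do not depend on \<open>n\<close>.\<close>

lemma u_star_eq:
  assumes "0 < T"
  shows "u_star a \<rho> n T v0 w0 t =
    - f_T T t \<cdot>\<^sub>v (2 \<cdot>\<^sub>v free_w t + \<rho> \<cdot>\<^sub>v free_v t) + - (6 * (T - 2 * t) / T ^ 3) \<cdot>\<^sub>v \<zeta> t"
proof (rule eq_vecI)
  let ?z = "\<lambda>t. the (mat_inverse (Kalman_mat a \<rho> n)) *\<^sub>v orbit t"
  have z: "?z t \<in> carrier_vec (n\<^sup>2 + n\<^sup>2)" for t
    by (rule mult_mat_vec_carrier[OF Kalman_mat_inverse(1)[OF a_pos] orbit_carrier])
  have dim_z: "dim_vec (?z t) = n\<^sup>2 + n\<^sup>2" for t
    using z[of t] by (rule carrier_vecD)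
  have mu: "mu a \<rho> n T v0 w0 t = f_T T t \<cdot>\<^sub>v - ?z t" for t
    by (simp add: mu_def orbit_def)
  fix i assume "i < dim_vec (- f_T T t \<cdot>\<^sub>v (2 \<cdot>\<^sub>v free_w t + \<rho> \<cdot>\<^sub>v free_v t) + - (6 * (T - 2 * t) / T ^ 3) \<cdot>\<^sub>v \<zeta> t)"
  then have i: "i < n\<^sup>2"
    by simp
  have "mu0 a \<rho> n T v0 w0 t $ i = - f_T T t * vec_first (?z t) (n\<^sup>2) $ i"
    unfolding mu0_def mu vec_first_def using i by (simp add: dim_z del: dim_mult_mat_vec index_mult_mat_vec)
  also have "vec_first (?z t) (n\<^sup>2) = free_w t + \<rho> \<cdot>\<^sub>v free_v t"
    unfolding orbit_eq by (intro Kalman_mat_solve(2) a_pos carriers)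
  finally have mu0: "mu0 a \<rho> n T v0 w0 t $ i = - f_T T t * (free_w t $ i + \<rho> * free_v t $ i)"
    using i by simp
  have "mu1 a \<rho> n T v0 w0 s $ i = - (f_T T s * \<zeta> s $ i)" for s
    unfolding mu1_def mu \<zeta>_def vec_last_def using i
    by (simp add: dim_z del: dim_mult_mat_vec index_mult_mat_vec)
  moreover have "((\<lambda>s. - (f_T T s * \<zeta> s $ i)) has_real_derivative
      - (6 * (T - 2 * t) / T ^ 3 * \<zeta> t $ i + free_w t $ i * f_T T t)) (at t)"
    using index_deriv(3)[OF i] f_T_deriv[OF assms] by (intro DERIV_minus DERIV_mult)
  ultimately have "deriv (\<lambda>s. mu1 a \<rho> n T v0 w0 s $ i) t =
      - (6 * (T - 2 * t) / T ^ 3 * \<zeta> t $ i + free_w t $ i * f_T T t)"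
    by (simp add: DERIV_imp_deriv)
  then show "u_star a \<rho> n T v0 w0 t $ i =
      (- f_T T t \<cdot>\<^sub>v (2 \<cdot>\<^sub>v free_w t + \<rho> \<cdot>\<^sub>v free_v t) + - (6 * (T - 2 * t) / T ^ 3) \<cdot>\<^sub>v \<zeta> t) $ i"
    using i mu0 by (simp add: u_star_def algebra_simps)
qed (simp add: u_star_def)

text \<open>The controlled motion is the free motion switched off by the cutoff. The correction
  \<open>- f_T \<zeta>\<close> is what the first equation demands: differentiating \<open>cutoff * free_v\<close> leaves the
  extra term \<open>- f_T free_v = D (- f_T \<zeta>)\<close>. It vanishes at both ends, since \<open>f_T\<close> does.\<close>

definition v_ctrl :: "real \<Rightarrow> real \<Rightarrow> real Matrix.vec" where
  "v_ctrl T t = cutoff T t \<cdot>\<^sub>v free_v t"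

definition w_ctrl :: "real \<Rightarrow> real \<Rightarrow> real Matrix.vec" where
  "w_ctrl T t = cutoff T t \<cdot>\<^sub>v free_w t - f_T T t \<cdot>\<^sub>v \<zeta> t"

text \<open>In the second equation the product rule leaves \<open>- f_T free_w\<close> from the cutoff and
  \<open>- f_T' \<zeta> - f_T free_w\<close> from the correction, while the damping of the correction contributes
  \<open>- \<rho> f_T free_v\<close>. Their sum is exactly the control computed in \<open>u_star_eq\<close>.\<close>

lemma controlled_solution:
  assumes "0 < T"
  shows "is_solution a \<rho> n T v0 w0 (u_star a \<rho> n T v0 w0) (v_ctrl T) (w_ctrl T)"
  unfolding is_solution_def
proof (intro conjI ballI allI impI)
  fix t
  show "v_ctrl T t \<in> carrier_vec (n\<^sup>2)" "w_ctrl T t \<in> carrier_vec (n\<^sup>2)"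
    by (simp_all add: v_ctrl_def w_ctrl_def)
next
  have "cutoff T 0 = 1" "f_T T 0 = 0"
    by (simp_all add: cutoff_def f_T_def)
  then show "v_ctrl T 0 = v0" "w_ctrl T 0 = w0"
    using v0 w0 by (auto simp: v_ctrl_def w_ctrl_def free_initial intro!: eq_vecI)
next
  fix t i assume i: "i < n\<^sup>2"
  have D_comb: "D *\<^sub>v (b \<cdot>\<^sub>v x - c \<cdot>\<^sub>v \<zeta> t) = b \<cdot>\<^sub>v (D *\<^sub>v x) - c \<cdot>\<^sub>v free_v t"
    if "x \<in> carrier_vec (n\<^sup>2)" for b c x
    using that by (simp add: mult_minus_distrib_mat_vec[OF D_mat_carrier] mult_mat_vec[OF D_mat_carrier] D_\<zeta>)
  have Dw: "(D *\<^sub>v w_ctrl T t) $ i = cutoff T t * (D *\<^sub>v free_w t) $ i - f_T T t * free_v t $ i"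
    unfolding w_ctrl_def D_comb[OF carriers(2)] using i by (simp del: index_mult_mat_vec)
  have "v_ctrl T t + \<rho> \<cdot>\<^sub>v w_ctrl T t = cutoff T t \<cdot>\<^sub>v (free_v t + \<rho> \<cdot>\<^sub>v free_w t) - (\<rho> * f_T T t) \<cdot>\<^sub>v \<zeta> t"
    by (intro eq_vecI) (auto simp: v_ctrl_def w_ctrl_def algebra_simps)
  then have Dvw: "(D *\<^sub>v (v_ctrl T t + \<rho> \<cdot>\<^sub>v w_ctrl T t)) $ i
      = cutoff T t * (D *\<^sub>v (free_v t + \<rho> \<cdot>\<^sub>v free_w t)) $ i - \<rho> * f_T T t * free_v t $ i"
    using i by (simp add: D_comb del: index_mult_mat_vec)
  have "((\<lambda>s. cutoff T s * free_v s $ i) has_real_derivative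
      - f_T T t * free_v t $ i + (D *\<^sub>v free_w t) $ i * cutoff T t) (at t within {0..T})"
    by (intro DERIV_mult cutoff_deriv[OF assms] index_deriv(1)[OF i])
  moreover have "v_ctrl T s $ i = cutoff T s * free_v s $ i" for s
    using i by (simp add: v_ctrl_def)
  ultimately show "((\<lambda>s. v_ctrl T s $ i) has_real_derivative (D *\<^sub>v w_ctrl T t) $ i) (at t within {0..T})"
    unfolding Dw by (simp add: algebra_simps del: index_mult_mat_vec)
  have "((\<lambda>s. cutoff T s * free_w s $ i - f_T T s * \<zeta> s $ i) has_real_derivative
      (- f_T T t * free_w t $ i + - (D *\<^sub>v (free_v t + \<rho> \<cdot>\<^sub>v free_w t)) $ i * cutoff T t)
      - (6 * (T - 2 * t) / T ^ 3 * \<zeta> t $ i + free_w t $ i * f_T T t)) (at t within {0..T})"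
    by (intro DERIV_mult DERIV_diff cutoff_deriv[OF assms] f_T_deriv[OF assms] index_deriv[OF i])
  moreover have "w_ctrl T s $ i = cutoff T s * free_w s $ i - f_T T s * \<zeta> s $ i" for s
    using i by (simp add: w_ctrl_def)
  moreover have "(- (D *\<^sub>v (v_ctrl T t + \<rho> \<cdot>\<^sub>v w_ctrl T t)) + u_star a \<rho> n T v0 w0 t) $ i =
      (- f_T T t * free_w t $ i + - (D *\<^sub>v (free_v t + \<rho> \<cdot>\<^sub>v free_w t)) $ i * cutoff T t)
      - (6 * (T - 2 * t) / T ^ 3 * \<zeta> t $ i + free_w t $ i * f_T T t)"
  proof -
    have "(- (D *\<^sub>v (v_ctrl T t + \<rho> \<cdot>\<^sub>v w_ctrl T t)) + u_star a \<rho> n T v0 w0 t) $ i =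
        - (D *\<^sub>v (v_ctrl T t + \<rho> \<cdot>\<^sub>v w_ctrl T t)) $ i + u_star a \<rho> n T v0 w0 t $ i"
      using i by (simp add: u_star_eq[OF assms] del: index_mult_mat_vec)
    then show ?thesis
      using i unfolding Dvw by (simp add: u_star_eq[OF assms] algebra_simps del: index_mult_mat_vec)
  qed
  ultimately show "((\<lambda>s. w_ctrl T s $ i) has_real_derivative
      (- (D *\<^sub>v (v_ctrl T t + \<rho> \<cdot>\<^sub>v w_ctrl T t)) + u_star a \<rho> n T v0 w0 t) $ i) (at t within {0..T})"
    by simp
qed

lemma controlled_solution_final:
  assumes "0 < T"
  shows "v_ctrl T T = 0\<^sub>v (n\<^sup>2)" and "w_ctrl T T = 0\<^sub>v (n\<^sup>2)"
proof -
  have "cutoff T T = 0" "f_T T T = 0"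
    using assms by (simp_all add: cutoff_def f_T_def power2_eq_square power3_eq_cube)
  then show "v_ctrl T T = 0\<^sub>v (n\<^sup>2)" "w_ctrl T T = 0\<^sub>v (n\<^sup>2)"
    by (auto simp: v_ctrl_def w_ctrl_def intro!: eq_vecI)
qed

lemma D_psd:
  assumes "x \<in> carrier_vec (n\<^sup>2)"
  shows "0 \<le> x \<bullet> (D *\<^sub>v x)"
  using D_mat_coercive[OF a_pos assms] a_pos
  by (meson order_trans zero_le_power2 mult_nonneg_nonneg divide_nonneg_nonneg zero_le_numeral)

lemma free_energy_le:
  assumes "0 \<le> t"
  shows "(vnorm (free_v t))\<^sup>2 + (vnorm (free_w t))\<^sup>2 \<le> (vnorm (v0 @\<^sub>v w0))\<^sup>2"
proof -
  have "(vnorm (free_v t))\<^sup>2 + (vnorm (free_w t))\<^sup>2 \<le> (vnorm (free_v 0))\<^sup>2 + (vnorm (free_w 0))\<^sup>2"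
    using D_mat_carrier D_mat_symmetric D_psd \<rho>_nonneg assms
    by (rule damped_energy_nonincreasing)
       (auto simp: has_comp_deriv_def intro: index_deriv simp del: index_mult_mat_vec)
  then show ?thesis
    by (simp add: free_initial vnorm_append_power2)
qed

text \<open>The difference of two solutions solves the uncontrolled system with zero data, hence has zero
  energy.\<close>

lemma solution_unique:
  assumes "0 \<le> T"
    and s1: "is_solution a \<rho> n T v0 w0 u v1 w1" and s2: "is_solution a \<rho> n T v0 w0 u v2 w2"
    and u: "\<And>t. t \<in> {0..T} \<Longrightarrow> u t \<in> carrier_vec (n\<^sup>2)"
  shows "v1 T = v2 T" and "w1 T = w2 T"
proof -
  have c: "v1 t \<in> carrier_vec (n\<^sup>2)" "w1 t \<in> carrier_vec (n\<^sup>2)"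
      "v2 t \<in> carrier_vec (n\<^sup>2)" "w2 t \<in> carrier_vec (n\<^sup>2)" if "t \<in> {0..T}" for t
    using s1 s2 that by (auto simp: is_solution_def)
  (* A difference of vectors has the dimension of its second argument, which is unknown outside
     the interval; these functions have dimension n^2 for every time. *)
  define v w where "v = (\<lambda>t. Matrix.vec (n\<^sup>2) (\<lambda>i. v1 t $ i - v2 t $ i))"
    and "w = (\<lambda>t. Matrix.vec (n\<^sup>2) (\<lambda>i. w1 t $ i - w2 t $ i))"
  have vw: "v t = v1 t - v2 t" "w t = w1 t - w2 t" if "t \<in> {0..T}" for t
    using c[OF that] by (auto simp: v_def w_def intro!: eq_vecI)
  have energy: "(vnorm (v T))\<^sup>2 + (vnorm (w T))\<^sup>2 \<le> (vnorm (v 0))\<^sup>2 + (vnorm (w 0))\<^sup>2"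
    using D_mat_carrier D_mat_symmetric D_psd \<rho>_nonneg \<open>0 \<le> T\<close>
  proof (rule damped_energy_nonincreasing)
    fix t assume t: "t \<in> {0..T}"
    note ct = c[OF t]
    show "v t \<in> carrier_vec (n\<^sup>2) \<and> w t \<in> carrier_vec (n\<^sup>2)"
      by (simp add: v_def w_def)
    have Dw: "D *\<^sub>v w t = D *\<^sub>v w1 t - D *\<^sub>v w2 t"
      using ct by (simp add: vw[OF t] mult_minus_distrib_mat_vec[OF D_mat_carrier])
    show "has_comp_deriv v (D *\<^sub>v w t) (at t within {0..T})"
      unfolding has_comp_deriv_def Dw
    proof (intro allI impI)
      fix i assume "i < dim_vec (D *\<^sub>v w1 t - D *\<^sub>v w2 t)"
      then have i: "i < n\<^sup>2"
        by simp
      have "((\<lambda>t. v1 t $ i - v2 t $ i) has_real_derivative (D *\<^sub>v w1 t) $ i - (D *\<^sub>v w2 t) $ i) (at t within {0..T})"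
        using s1 s2 t i by (intro DERIV_diff) (auto simp: is_solution_def simp del: index_mult_mat_vec)
      then show "((\<lambda>t. v t $ i) has_real_derivative (D *\<^sub>v w1 t - D *\<^sub>v w2 t) $ i) (at t within {0..T})"
        using i by (simp add: v_def del: index_mult_mat_vec)
    qed
    have "v t + \<rho> \<cdot>\<^sub>v w t = (v1 t + \<rho> \<cdot>\<^sub>v w1 t) - (v2 t + \<rho> \<cdot>\<^sub>v w2 t)"
      unfolding vw[OF t] using ct by (intro eq_vecI) (auto simp: algebra_simps)
    then have Dvw: "D *\<^sub>v (v t + \<rho> \<cdot>\<^sub>v w t) = D *\<^sub>v (v1 t + \<rho> \<cdot>\<^sub>v w1 t) - D *\<^sub>v (v2 t + \<rho> \<cdot>\<^sub>v w2 t)"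
      using ct by (simp add: mult_minus_distrib_mat_vec[OF D_mat_carrier])
    show "has_comp_deriv w (- (D *\<^sub>v (v t + \<rho> \<cdot>\<^sub>v w t))) (at t within {0..T})"
      unfolding has_comp_deriv_def Dvw
    proof (intro allI impI)
      fix i assume "i < dim_vec (- (D *\<^sub>v (v1 t + \<rho> \<cdot>\<^sub>v w1 t) - D *\<^sub>v (v2 t + \<rho> \<cdot>\<^sub>v w2 t)))"
      then have i: "i < n\<^sup>2"
        by simp
      have "((\<lambda>t. w1 t $ i - w2 t $ i) has_real_derivative
          (- (D *\<^sub>v (v1 t + \<rho> \<cdot>\<^sub>v w1 t)) + u t) $ i - (- (D *\<^sub>v (v2 t + \<rho> \<cdot>\<^sub>v w2 t)) + u t) $ i) (at t within {0..T})"
        using s1 s2 t i by (intro DERIV_diff) (auto simp: is_solution_def simp del: index_mult_mat_vec)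
      then show "((\<lambda>t. w t $ i) has_real_derivative
          (- (D *\<^sub>v (v1 t + \<rho> \<cdot>\<^sub>v w1 t) - D *\<^sub>v (v2 t + \<rho> \<cdot>\<^sub>v w2 t))) $ i) (at t within {0..T})"
        using i u[OF t] by (simp add: w_def algebra_simps del: index_mult_mat_vec)
    qed
  qed
  have "v 0 = 0\<^sub>v (n\<^sup>2)" "w 0 = 0\<^sub>v (n\<^sup>2)"
    using s1 s2 by (auto simp: v_def w_def is_solution_def intro!: eq_vecI)
  then have "vnorm (v T) = 0" "vnorm (w T) = 0"
    using energy vnorm_eq_0_iff[of "0\<^sub>v (n\<^sup>2)"] by (simp_all add: sum_power2_le_zero_iff)
  then have "v T = 0\<^sub>v (n\<^sup>2)" "w T = 0\<^sub>v (n\<^sup>2)"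
    using vnorm_eq_0_iff[of "v T"] vnorm_eq_0_iff[of "w T"] by (simp_all add: v_def w_def)
  then have eq: "v1 T $ i - v2 T $ i = 0" "w1 T $ i - w2 T $ i = 0" if "i < n\<^sup>2" for i
  proof -
    have "v T $ i = 0" "w T $ i = 0"
      using \<open>v T = _\<close> \<open>w T = _\<close> that by simp_all
    then show "v1 T $ i - v2 T $ i = 0" "w1 T $ i - w2 T $ i = 0"
      using that by (simp_all add: v_def w_def)
  qed
  show "v1 T = v2 T" "w1 T = w2 T"
    using c[of T] \<open>0 \<le> T\<close> eq by (auto intro!: eq_vecI)
qed

text \<open>By energy decay the two halves of the free motion are bounded by the data, and coercivity bounds
  \<open>\<zeta>\<close> by \<open>a\<^sup>2 / 8\<close> times the data. The weights are \<open>f_T \<le> 3 / (2 T)\<close> and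
  \<open>\<bar>f_T'\<bar> \<le> 6 / T\<^sup>2\<close>.\<close>

lemma u_star_vnorm_le:
  assumes "0 < T" and t: "t \<in> {0..T}"
  shows "vnorm (u_star a \<rho> n T v0 w0 t)
    \<le> (3 * (2 + \<rho>) / (2 * T) + 3 * a\<^sup>2 / (4 * T\<^sup>2)) * vnorm (v0 @\<^sub>v w0)"
proof -
  let ?Y = "vnorm (v0 @\<^sub>v w0)" and ?f' = "6 * (T - 2 * t) / T ^ 3"
  have "(vnorm (free_v t))\<^sup>2 \<le> ?Y\<^sup>2" "(vnorm (free_w t))\<^sup>2 \<le> ?Y\<^sup>2"
    using free_energy_le[of t] t zero_le_power2[of "vnorm (free_v t)"] zero_le_power2[of "vnorm (free_w t)"]
    unfolding atLeastAtMost_iff by linarith+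
  then have v_le: "vnorm (free_v t) \<le> ?Y" and w_le: "vnorm (free_w t) \<le> ?Y"
    using vnorm_nonneg by (blast intro: power2_le_imp_le)+
  have z: "vnorm (\<zeta> t) \<le> a\<^sup>2 / 8 * ?Y"
  proof -
    have "vnorm (\<zeta> t) \<le> a\<^sup>2 / 8 * vnorm (free_v t)"
      using D_mat_inverse_bound[OF a_pos carriers(3)] unfolding D_\<zeta> .
    also have "\<dots> \<le> a\<^sup>2 / 8 * ?Y"
      using v_le by (intro mult_left_mono) auto
    finally show ?thesis .
  qed
  have qp: "vnorm (2 \<cdot>\<^sub>v free_w t + \<rho> \<cdot>\<^sub>v free_v t) \<le> (2 + \<rho>) * ?Y"
    using vnorm_triangle[of "2 \<cdot>\<^sub>v free_w t" "n\<^sup>2" "\<rho> \<cdot>\<^sub>v free_v t"] w_le mult_left_mono[OF v_le \<rho>_nonneg] \<rho>_nonneg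
    by (simp add: vnorm_smult algebra_simps)
  have "vnorm (u_star a \<rho> n T v0 w0 t)
      \<le> \<bar>f_T T t\<bar> * vnorm (2 \<cdot>\<^sub>v free_w t + \<rho> \<cdot>\<^sub>v free_v t) + \<bar>?f'\<bar> * vnorm (\<zeta> t)"
    unfolding u_star_eq[OF assms(1)]
    using vnorm_triangle[of "- f_T T t \<cdot>\<^sub>v (2 \<cdot>\<^sub>v free_w t + \<rho> \<cdot>\<^sub>v free_v t)" "n\<^sup>2" "- ?f' \<cdot>\<^sub>v \<zeta> t"]
    by (simp only: vnorm_smult abs_minus_cancel smult_carrier_vec add_carrier_vec carriers)
  also have "\<dots> \<le> 3 / (2 * T) * ((2 + \<rho>) * ?Y) + 6 / T\<^sup>2 * (a\<^sup>2 / 8 * ?Y)"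
    using assms by (intro add_mono mult_mono f_T_abs_le f_T_deriv_abs_le qp z) auto
  also have "\<dots> = (3 * (2 + \<rho>) / (2 * T) + 3 * a\<^sup>2 / (4 * T\<^sup>2)) * ?Y"
    using assms by (simp add: field_simps)
  finally show ?thesis .
qed

lemma u_star_carrier: "u_star a \<rho> n T v0 w0 t \<in> carrier_vec (n\<^sup>2)"
  by (rule carrier_vecI) (simp add: u_star_def)

lemma u_star_continuous:
  assumes "0 < T" and i: "i < n\<^sup>2"
  shows "continuous_on S (\<lambda>t. u_star a \<rho> n T v0 w0 t $ i)"
proof -
  have "continuous_on S (\<lambda>t. free_v t $ i)" "continuous_on S (\<lambda>t. free_w t $ i)" "continuous_on S (\<lambda>t. \<zeta> t $ i)"
    by (rule DERIV_continuous_on, rule index_deriv[OF i])+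
  moreover have "continuous_on S (f_T T)"
    by (rule DERIV_continuous_on, rule f_T_deriv[OF assms(1)])
  ultimately have "continuous_on S (\<lambda>t. - f_T T t * (2 * free_w t $ i + \<rho> * free_v t $ i)
      + - (6 * (T - 2 * t) / T ^ 3) * \<zeta> t $ i)"
    using assms(1) by (intro continuous_intros) auto
  then show ?thesis
    using i by (simp add: u_star_eq[OF assms(1)])
qed

lemma u_star_vnorm_continuous:
  assumes "0 < T"
  shows "continuous_on S (\<lambda>t. (vnorm (u_star a \<rho> n T v0 w0 t))\<^sup>2)"
proof -
  have "dim_vec (u_star a \<rho> n T v0 w0 t) = n\<^sup>2" for t
    using u_star_carrier by (rule carrier_vecD)
  then show ?thesis
    using u_star_continuous[OF assms] by (auto simp: vnorm_power2 intro!: continuous_intros)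
qed

lemma u_star_in_L2:
  assumes "0 < T"
  shows "in_L2 T (n\<^sup>2) (u_star a \<rho> n T v0 w0)"
  unfolding in_L2_def
proof (intro conjI ballI allI impI)
  show "u_star a \<rho> n T v0 w0 t \<in> carrier_vec (n\<^sup>2)" for t
    by (rule u_star_carrier)
  show "(\<lambda>t. u_star a \<rho> n T v0 w0 t $ i) \<in> borel_measurable (lebesgue_on {0..T})" if "i < n\<^sup>2" for i
    using u_star_continuous[OF assms that] by (rule continuous_imp_measurable_on_sets_lebesgue) simp
  show "integrable (lebesgue_on {0..T}) (\<lambda>t. (vnorm (u_star a \<rho> n T v0 w0 t))\<^sup>2)"
    by (intro continuous_imp_integrable_real u_star_vnorm_continuous assms)
qed

text \<open>For \<open>T \<le> T0\<close> the weight \<open>1 / T\<close> is at most \<open>T0 / T\<^sup>2\<close>, so the control is bounded pointwise by a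
  multiple of \<open>T\<^bsup>-2\<^esup>\<close>; integrating over an interval of length \<open>T\<close> gains the factor \<open>T\<^bsup>1/2\<^esup>\<close>.\<close>

lemma u_star_L2_le:
  assumes "0 < T" and "T \<le> T0"
  shows "sqrt (\<integral>t. (vnorm (u_star a \<rho> n T v0 w0 t))\<^sup>2 \<partial>lebesgue_on {0..T})
    \<le> (3 * (2 + \<rho>) / 2 * T0 + 3 * a\<^sup>2 / 4) * T powr (-3/2) * vnorm (v0 @\<^sub>v w0)"
proof -
  let ?u = "u_star a \<rho> n T v0 w0"
  let ?C = "3 * (2 + \<rho>) / 2 * T0 + 3 * a\<^sup>2 / 4"
  define M where "M = ?C / T\<^sup>2 * vnorm (v0 @\<^sub>v w0)"
  have "0 \<le> M"
    using assms \<rho>_nonneg by (simp add: M_def)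
  have le: "vnorm (?u t) \<le> M" if "t \<in> {0..T}" for t
  proof -
    have "3 * (2 + \<rho>) / (2 * T) = 3 * (2 + \<rho>) / 2 * T / T\<^sup>2"
      using assms by (simp add: power2_eq_square)
    also have "\<dots> \<le> 3 * (2 + \<rho>) / 2 * T0 / T\<^sup>2"
      using assms \<rho>_nonneg by (intro divide_right_mono mult_left_mono) auto
    finally have "3 * (2 + \<rho>) / (2 * T) + 3 * a\<^sup>2 / (4 * T\<^sup>2) \<le> ?C / T\<^sup>2"
      by (simp add: add_divide_distrib)
    then have "(3 * (2 + \<rho>) / (2 * T) + 3 * a\<^sup>2 / (4 * T\<^sup>2)) * vnorm (v0 @\<^sub>v w0) \<le> M"
      unfolding M_def by (rule mult_right_mono) simp
    then show ?thesis
      using u_star_vnorm_le[OF assms(1) that] by linarith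
  qed
  have int: "integrable (lebesgue_on {0..T}) (\<lambda>t. (vnorm (?u t))\<^sup>2)"
    using u_star_in_L2[OF assms(1)] by (simp add: in_L2_def)
  have "(\<integral>t. (vnorm (?u t))\<^sup>2 \<partial>lebesgue_on {0..T}) = integral {0..T} (\<lambda>t. (vnorm (?u t))\<^sup>2)"
    by (rule lebesgue_integral_eq_integral[OF int]) simp
  also have "\<dots> \<le> integral {0..T} (\<lambda>t. M\<^sup>2)"
    using le u_star_vnorm_continuous[OF assms(1)]
    by (intro integral_le integrable_continuous_real power_mono) auto
  also have "\<dots> = T * M\<^sup>2"
    using assms by simp
  finally have "sqrt (\<integral>t. (vnorm (?u t))\<^sup>2 \<partial>lebesgue_on {0..T}) \<le> sqrt (T * M\<^sup>2)"
    by (rule real_sqrt_le_mono)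
  also have "\<dots> = sqrt T * M"
    using \<open>0 \<le> M\<close> by (simp add: real_sqrt_mult)
  also have "sqrt T = T powr (-3/2 + 2)"
    using assms by (simp add: powr_half_sqrt)
  also have "\<dots> = T powr (-3/2) * T\<^sup>2"
    unfolding powr_add using assms by simp
  also have "\<dots> * M = ?C * T powr (-3/2) * vnorm (v0 @\<^sub>v w0)"
    unfolding M_def using assms by simp
  finally show ?thesis .
qed

end

theorem theorem3p1:
  fixes a \<rho> :: real
  assumes "a > 0" and "\<rho> > 0" and "\<rho> \<noteq> 2"
  shows "\<forall>T0>0. \<exists>C>0. \<forall>T. 0 < T \<and> T \<le> T0 \<longrightarrow>
    (\<forall>n::nat. n \<ge> 1 \<longrightarrow>
      (\<forall>v0\<in>carrier_vec (n\<^sup>2). \<forall>w0\<in>carrier_vec (n\<^sup>2).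
        let u = u_star a \<rho> n T v0 w0 in
          in_L2 T (n\<^sup>2) u \<and>
          (\<exists>v w. is_solution a \<rho> n T v0 w0 u v w) \<and>
          (\<forall>v w. is_solution a \<rho> n T v0 w0 u v w \<longrightarrow> v T = 0\<^sub>v (n\<^sup>2) \<and> w T = 0\<^sub>v (n\<^sup>2)) \<and>
          sqrt (\<integral>t. (vnorm (u t))\<^sup>2 \<partial>lebesgue_on {0..T})
            \<le> C * T powr (-3/2) * vnorm (v0 @\<^sub>v w0)))"
proof (intro allI impI, goal_cases)
  case (1 T0)
  define C where "C = 3 * (2 + \<rho>) / 2 * T0 + 3 * a\<^sup>2 / 4"
  have "0 < C"
    using assms 1 by (simp add: C_def add_pos_pos)
  have "let u = u_star a \<rho> n T v0 w0 in
      in_L2 T (n\<^sup>2) u \<and>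
      (\<exists>v w. is_solution a \<rho> n T v0 w0 u v w) \<and>
      (\<forall>v w. is_solution a \<rho> n T v0 w0 u v w \<longrightarrow> v T = 0\<^sub>v (n\<^sup>2) \<and> w T = 0\<^sub>v (n\<^sup>2)) \<and>
      sqrt (\<integral>t. (vnorm (u t))\<^sup>2 \<partial>lebesgue_on {0..T}) \<le> C * T powr (-3/2) * vnorm (v0 @\<^sub>v w0)"
    if T: "0 < T" "T \<le> T0" and data: "v0 \<in> carrier_vec (n\<^sup>2)" "w0 \<in> carrier_vec (n\<^sup>2)" for T n v0 w0
  proof -
    interpret free_system a \<rho> n v0 w0
      using assms data by unfold_locales auto
    note sol = controlled_solution[OF T(1)]
    have "v T = 0\<^sub>v (n\<^sup>2) \<and> w T = 0\<^sub>v (n\<^sup>2)"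
      if "is_solution a \<rho> n T v0 w0 (u_star a \<rho> n T v0 w0) v w" for v w
      using solution_unique[OF less_imp_le[OF T(1)] that sol u_star_carrier]
        controlled_solution_final[OF T(1)] by simp
    then show ?thesis
      using sol u_star_in_L2[OF T(1)] u_star_L2_le[OF T] unfolding Let_def C_def by blast
  qed
  with \<open>0 < C\<close> show ?case
    by blast
qed

end
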